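(* Let $K$ be a Dugundji compact space of weight $\aleph_1$. Then the Banach space $C(K)$ has a projectional resolution of the identity $\{P_\alpha\}_{\alpha<\omega_1}$ such that each $P_\alpha\colon C(K)\to C(K)$ is regular. In particular, $C(K)$ is $1$-Plichko and the space $P(K)$ of probability measures on $K$ is Valdivia compact.
   Context: All compact spaces are Hausdorff; "map" means continuous map. $C(K)$ is the Banach space of real-valued continuous functions on $K$ with the supremum norm. $\omega_1$ is the first uncountable ordinal. A compact space $K$ is a Dugundji compact if it is an absolute extensor for the class of all $0$-dimensional compact spaces: for every $0$-dimensional compact space $X$, every closed $A\subseteq X$ and every continuous map $f\colon A\to K$, there is a continuous map $F\colon X\to K$ with $F\restriction A=f$. A projection in a Banach space $E$ is a bounded linear operator $P\colon E\to E$ with $PP=P$; $\operatorname{im}P=\{Px: x\in E\}$. A linear operator $T\colon C(K)\to C(K)$ is regular if it is positive ($Tf\geq 0$ whenever $f\geq 0$) and $T1=1$, where $1$ is the constant function with value $1$. A projectional resolution of the identity $\{P_\alpha\}_{\alpha<\omega_1}$ on a Banach space $E$ (of density $\aleph_1$) is a sequence of norm one projections of $E$ onto separable subspaces such that: (1) $\alpha<\beta$ implies $P_\alpha=P_\alpha P_\beta=P_\beta P_\alpha$; (2) $\bigcup_{\alpha<\omega_1}\operatorname{im}P_\alpha=E$, and $\operatorname{im}P_\delta=\operatorname{cl}\left(\bigcup_{\alpha<\delta}\operatorname{im}P_{\alpha+1}\right)$ for every limit ordinal $\delta<\omega_1$. A Banach space $E$ is $1$-Plichko if there are a linearly dense set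 $X\subseteq E$ (i.e. the linear span of $X$ is dense in $E$) and a $1$-norming set $Y\subseteq E^*$ such that for every $y\in Y$ the set $\{x\in X: y(x)\neq 0\}$ is countable. Here $Y$ is $1$-norming if $\|v\|\leq \sup\{|y(v)|/\|y\| : y\in Y,\ y\ne 0\}$ for every $v\in E$. $P(K)=\{\mu\in C(K)^*: \|\mu\|=1 \text{ and } \mu(\varphi)\geq 0 \text{ for every } \varphi\geq 0\}$, with the weak-star topology inherited from $C(K)^*$ (the space of regular Borel probability measures on $K$). For a cardinal $\kappa$ let $\Sigma(\kappa)=\{x\in[0,1]^\kappa : |\{\alpha: x(\alpha)\neq 0\}|\leq\aleph_0\}$. A compact space $L$ is Valdivia compact if, for some $\kappa$, $L$ is homeomorphic to a subspace $L'\subseteq[0,1]^\kappa$ such that $L'\cap\Sigma(\kappa)$ is dense in $L'$. *)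

theory Defs
  imports "HOL-Analysis.Analysis"
begin

unbundle cardinal_syntax

section \<open>The cardinal \<open>\<aleph>\<^sub>1\<close> and the ordinals below \<open>\<omega>\<^sub>1\<close>\<close>

abbreviation aleph_one :: "nat set rel"
  where "aleph_one \<equiv> cardSuc natLeq"

text \<open>A cardinal in the HOL library is a well-order of minimal order type among the well-orders of
  its field, so the well-order \<^term>\<open>aleph_one\<close> is a copy of the set of ordinals below
  \<open>\<omega>\<^sub>1\<close>.\<close>

typedef omega_one = "Field aleph_one"
  using Field_cardSuc_not_empty[OF natLeq_Card_order] by blast

lemma countable_iff_natLeq: "countable A \<longleftrightarrow> card_of A \<le>o natLeq"
proof -
  have "countable A \<longleftrightarrow> card_of A \<le>o card_of (UNIV :: nat set)"
    unfolding countable_def using card_of_ordLeq[of A "UNIV :: nat set"] by simp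
  also have "\<dots> \<longleftrightarrow> card_of A \<le>o natLeq"
    using card_of_nat ordLeq_ordIso_trans ordIso_symmetric by blast
  finally show ?thesis .
qed

lemma Well_order_aleph_one: "Well_order aleph_one"
  using cardSuc_Card_order[OF natLeq_Card_order] card_order_on_well_order_on by blast

instantiation omega_one :: wellorder
begin

definition less_eq_omega_one :: "omega_one \<Rightarrow> omega_one \<Rightarrow> bool"
  where "\<alpha> \<le> \<beta> \<longleftrightarrow> (Rep_omega_one \<alpha>, Rep_omega_one \<beta>) \<in> aleph_one"

definition less_omega_one :: "omega_one \<Rightarrow> omega_one \<Rightarrow> bool"
  where "\<alpha> < \<beta> \<longleftrightarrow> \<alpha> \<le> \<beta> \<and> \<alpha> \<noteq> (\<beta>::omega_one)"

instance
proof
  have lo: "Linear_order aleph_one"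
    using Well_order_aleph_one by (simp add: well_order_on_def)
  have wf: "wf (aleph_one - Id)"
    using Well_order_aleph_one by (simp add: well_order_on_def)
  have po: "refl_on (Field aleph_one) aleph_one" "trans aleph_one" "antisym aleph_one"
    "total_on (Field aleph_one) aleph_one"
    using lo by (auto simp: order_on_defs)
  fix x y z :: omega_one
  show refl: "x \<le> x"
    using po(1) Rep_omega_one unfolding less_eq_omega_one_def refl_on_def by blast
  show "x \<le> y \<Longrightarrow> y \<le> z \<Longrightarrow> x \<le> z"
    using po(2) unfolding less_eq_omega_one_def trans_def by blast
  show anti: "x \<le> y \<Longrightarrow> y \<le> x \<Longrightarrow> x = y"
    using po(3) unfolding less_eq_omega_one_def antisym_def by (meson Rep_omega_one_inject)
  then show "(x < y) = (x \<le> y \<and> \<not> y \<le> x)"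
    using refl unfolding less_omega_one_def by auto
  show "x \<le> y \<or> y \<le> x"
    using po(4) refl Rep_omega_one[of x] Rep_omega_one[of y]
    unfolding less_eq_omega_one_def total_on_def by (metis Rep_omega_one_inject)
  fix P :: "omega_one \<Rightarrow> bool" and a :: omega_one
  assume step: "\<And>x. (\<And>y. y < x \<Longrightarrow> P y) \<Longrightarrow> P x"
  have "wf (inv_image (aleph_one - Id) Rep_omega_one)"
    using wf by (rule wf_inv_image)
  then show "P a"
  proof (induction a rule: wf_induct_rule)
    case (less x)
    show ?case
    proof (rule step)
      fix y assume "y < x"
      then have "(y, x) \<in> inv_image (aleph_one - Id) Rep_omega_one"
        unfolding less_omega_one_def less_eq_omega_one_def in_inv_image
        by (simp add: Rep_omega_one_inject)
      then show "P y" by (rule less)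
    qed
  qed
qed

end

lemma uncountable_omega_one: "uncountable (UNIV :: omega_one set)"
proof
  assume "countable (UNIV :: omega_one set)"
  then have "countable (Rep_omega_one ` UNIV)" by (rule countable_image)
  then have "countable (Field aleph_one)"
    using type_definition.Rep_range[OF type_definition_omega_one] by simp
  then have "|Field aleph_one| \<le>o natLeq" by (simp add: countable_iff_natLeq)
  moreover have "|Field aleph_one| =o aleph_one"
    by (rule card_of_Field_ordIso) (rule cardSuc_Card_order[OF natLeq_Card_order])
  moreover have "natLeq <o aleph_one"
    by (rule cardSuc_greater) (rule natLeq_Card_order)
  ultimately show False
    using not_ordLess_ordLeq ordIso_ordLeq_trans ordIso_symmetric by blast
qed

lemma countable_below_omega_one: "countable {\<alpha>. \<alpha> < (\<beta>::omega_one)}"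
proof -
  have "|underS aleph_one (Rep_omega_one \<beta>)| <o aleph_one"
    by (rule card_of_underS) (use cardSuc_Card_order[OF natLeq_Card_order] Rep_omega_one in auto)
  then have "|underS aleph_one (Rep_omega_one \<beta>)| \<le>o natLeq"
    using cardSuc_ordLeq_ordLess[OF natLeq_Card_order card_of_Card_order] by blast
  then have "countable (underS aleph_one (Rep_omega_one \<beta>))"
    by (simp add: countable_iff_natLeq)
  moreover have "Rep_omega_one ` {\<alpha>. \<alpha> < \<beta>} \<subseteq> underS aleph_one (Rep_omega_one \<beta>)"
    by (auto simp: underS_def less_omega_one_def less_eq_omega_one_def Rep_omega_one_inject)
  ultimately have "countable (Rep_omega_one ` {\<alpha>. \<alpha> < \<beta>})"
    by (rule countable_subset[rotated])
  moreover have "inj_on Rep_omega_one {\<alpha>. \<alpha> < \<beta>}"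
    by (simp add: inj_on_def Rep_omega_one_inject)
  ultimately show ?thesis
    using countable_image_inj_on by blast
qed

definition osucc :: "omega_one \<Rightarrow> omega_one"
  where "osucc \<alpha> = (LEAST \<beta>. \<alpha> < \<beta>)"

lemma less_osucc: "\<alpha> < osucc \<alpha>"
proof -
  have "\<exists>\<beta>. \<alpha> < \<beta>"
  proof (rule ccontr)
    assume "\<not> ?thesis"
    then have "(UNIV :: omega_one set) \<subseteq> insert \<alpha> {\<beta>. \<beta> < \<alpha>}"
      by (auto simp: not_less order.order_iff_strict)
    then show False
      using uncountable_omega_one countable_below_omega_one
      by (meson countable_insert countable_subset)
  qed
  then show ?thesis unfolding osucc_def by (rule LeastI_ex)
qed

definition limit_ordinal :: "omega_one \<Rightarrow> bool"
  where "limit_ordinal \<delta> \<longleftrightarrow> (\<exists>\<alpha>. \<alpha> < \<delta>) \<and> (\<forall>\<alpha><\<delta>. osucc \<alpha> < \<delta>)"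


section \<open>Weight and density\<close>

definition has_weight :: "'a topology \<Rightarrow> 'c rel \<Rightarrow> bool"
  where "has_weight X \<kappa> \<longleftrightarrow>
    (\<exists>\<B>. openin X = arbitrary union_of (\<lambda>U. U \<in> \<B>) \<and> card_of \<B> =o \<kappa>) \<and>
    (\<forall>\<B>. openin X = arbitrary union_of (\<lambda>U. U \<in> \<B>) \<longrightarrow> \<kappa> \<le>o card_of \<B>)"

definition has_density :: "'a topology \<Rightarrow> 'c rel \<Rightarrow> bool"
  where "has_density X \<kappa> \<longleftrightarrow>
    (\<exists>D \<subseteq> topspace X. X closure_of D = topspace X \<and> card_of D =o \<kappa>) \<and>
    (\<forall>D \<subseteq> topspace X. X closure_of D = topspace X \<longrightarrow> \<kappa> \<le>o card_of D)"


section \<open>Dugundji compact spaces\<close>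

text \<open>HOL cannot quantify over all types inside a definition, so the test spaces \<open>X\<close> range over the
  topologies (with arbitrary carrier) on one type built from the point type of \<open>K\<close>. This is no
  restriction: by \<open>dugundji_compact_extends\<close> below, the spaces of every other type are covered as
  well. A space with \<open>X dim_le 0\<close> is one with a base of clopen sets
  (\<open>dimension_le_0_neighbourhood_base_of_clopen\<close>).\<close>

definition dugundji_compact :: "'a topology \<Rightarrow> bool"
  where "dugundji_compact K \<longleftrightarrow> compact_space K \<and> Hausdorff_space K \<and>
    (\<forall>(X :: ('a \<times> 'a \<Rightarrow> bool) topology) A f.
      compact_space X \<and> Hausdorff_space X \<and> X dim_le 0 \<and> closedin X A \<and>
      continuous_map (subtopology X A) K f \<longrightarrow>
      (\<exists>F. continuous_map X K F \<and> (\<forall>x\<in>A. F x = f x)))"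

lemma zero_dimensional_separation:
  assumes "compact_space X" "Hausdorff_space X" "X dim_le 0"
    and "closedin X S" "closedin X T" "S \<inter> T = {}"
  obtains C where "openin X C" "closedin X C" "S \<subseteq> C" "C \<inter> T = {}"
proof -
  have nb: "neighbourhood_base_of (\<lambda>U. closedin X U \<and> openin X U) X"
    using assms(3) by (simp add: dimension_le_0_neighbourhood_base_of_clopen)
  have "\<exists>V. closedin X V \<and> openin X V \<and> x \<in> V \<and> V \<inter> T = {}" if "x \<in> S" for x
  proof -
    have "openin X (topspace X - T)" using assms(5) by blast
    moreover have "x \<in> topspace X - T"
      using that assms(4,6) closedin_subset by blast
    ultimately obtain U V where "closedin X V" "openin X V" "openin X U" "x \<in> U" "U \<subseteq> V"
        "V \<subseteq> topspace X - T"
      using nb unfolding neighbourhood_base_of by meson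
    then show ?thesis by blast
  qed
  then obtain V where V: "\<And>x. x \<in> S \<Longrightarrow> closedin X (V x) \<and> openin X (V x) \<and> x \<in> V x \<and> V x \<inter> T = {}"
    by metis
  have "compactin X S"
    using assms(1,4) closedin_compact_space by blast
  moreover have "\<forall>U \<in> V ` S. openin X U" "S \<subseteq> \<Union>(V ` S)" using V by auto
  ultimately obtain \<F> where F: "finite \<F>" "\<F> \<subseteq> V ` S" "S \<subseteq> \<Union>\<F>"
    unfolding compactin_def by metis
  show thesis
  proof
    show "openin X (\<Union>\<F>)" using F V by (intro openin_Union) blast
    show "closedin X (\<Union>\<F>)" using F V by (intro closedin_Union) auto
    show "S \<subseteq> \<Union>\<F>" by (rule F)
    show "\<Union>\<F> \<inter> T = {}" using F V by blast
  qed
qed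

lemma dim_le_0_discrete_power:
  "product_topology (\<lambda>_. discrete_topology (UNIV :: bool set)) (UNIV :: 'i set) dim_le 0"
proof -
  let ?P = "product_topology (\<lambda>_. discrete_topology (UNIV :: bool set)) (UNIV :: 'i set)"
  show ?thesis
    unfolding dimension_le_0_neighbourhood_base_of_clopen neighbourhood_base_of
  proof (intro allI impI, elim conjE)
    fix W :: "('i \<Rightarrow> bool) set" and x assume W: "openin ?P W" "x \<in> W"
    obtain U where U: "finite {i \<in> UNIV. U i \<noteq> topspace (discrete_topology (UNIV :: bool set))}"
        "x \<in> Pi\<^sub>E UNIV U" "Pi\<^sub>E UNIV U \<subseteq> W"
      using bspec[OF iffD1[OF openin_product_topology_alt W(1)] W(2)] by (elim exE conjE) rule
    have op: "openin ?P (Pi\<^sub>E UNIV U)"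
      by (rule openin_PiE_gen[THEN iffD2]) (use U(1) in simp)
    have "closedin ?P (Pi\<^sub>E UNIV U)"
      by (rule closedin_product_topology[THEN iffD2]) simp
    with op U(2,3) show "\<exists>U V. openin ?P U \<and> (closedin ?P V \<and> openin ?P V) \<and> x \<in> U \<and> U \<subseteq> V \<and> V \<subseteq> W"
      by (intro exI[of _ "Pi\<^sub>E UNIV U"] conjI) simp_all
  qed
qed

lemma dim_le_0_subtopology:
  assumes "X dim_le 0" shows "subtopology X S dim_le 0"
  unfolding dimension_le_0_neighbourhood_base_of_clopen neighbourhood_base_of
proof (intro allI impI)
  fix W x assume W: "openin (subtopology X S) W \<and> x \<in> W"
  then obtain T where T: "openin X T" "W = T \<inter> S" unfolding openin_subtopology by blast
  have "neighbourhood_base_of (\<lambda>U. closedin X U \<and> openin X U) X"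
    using assms by (simp add: dimension_le_0_neighbourhood_base_of_clopen)
  then obtain V where V: "closedin X V" "openin X V" "x \<in> V" "V \<subseteq> T"
    using T W unfolding neighbourhood_base_of by (metis IntD1 subsetD)
  have "openin (subtopology X S) (V \<inter> S)" "closedin (subtopology X S) (V \<inter> S)"
    using V unfolding openin_subtopology closedin_subtopology by auto
  then show "\<exists>U V. openin (subtopology X S) U \<and>
      (closedin (subtopology X S) V \<and> openin (subtopology X S) V) \<and> x \<in> U \<and> U \<subseteq> V \<and> V \<subseteq> W"
    using V T W by blast
qed

theorem dugundji_compact_extends:
  fixes K :: "'a topology" and X :: "'x topology"
  assumes K: "dugundji_compact K"
    and X: "compact_space X" "Hausdorff_space X" "X dim_le 0"
    and A: "closedin X A"
    and f: "continuous_map (subtopology X A) K f"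
  shows "\<exists>F. continuous_map X K F \<and> (\<forall>x\<in>A. F x = f x)"
proof -
  have K': "compact_space K" "Hausdorff_space K" using K by (auto simp: dugundji_compact_def)
  have Asub: "A \<subseteq> topspace X" using A closedin_subset by blast
  have fA: "f x \<in> topspace K" if "x \<in> A" for x
    using f that Asub by (auto simp: continuous_map_def)
  let ?sep = "\<lambda>a b C. openin X C \<and> closedin X C \<and>
      (a \<in> topspace K \<and> b \<in> topspace K \<and> a \<noteq> b \<longrightarrow>
        {x\<in>A. f x = a} \<subseteq> C \<and> C \<inter> {x\<in>A. f x = b} = {})"
  have ex: "\<exists>C. ?sep a b C" for a b
  proof (cases "a \<in> topspace K \<and> b \<in> topspace K \<and> a \<noteq> b")
    case True
    have cl: "closedin X {x\<in>A. f x = c}" if "c \<in> topspace K" for c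
    proof -
      have "closedin K {c}" using K'(2) that by (simp add: closedin_Hausdorff_sing_eq)
      then have "closedin (subtopology X A) {x \<in> topspace (subtopology X A). f x \<in> {c}}"
        using f by (rule closedin_continuous_map_preimage[rotated])
      moreover have "{x \<in> topspace (subtopology X A). f x \<in> {c}} = {x\<in>A. f x = c}"
        using Asub by auto
      ultimately show ?thesis using A closedin_trans_full by metis
    qed
    have "{x\<in>A. f x = a} \<inter> {x\<in>A. f x = b} = {}" using True by auto
    then obtain C where "openin X C" "closedin X C" "{x\<in>A. f x = a} \<subseteq> C"
        "C \<inter> {x\<in>A. f x = b} = {}"
      using True by (elim zero_dimensional_separation[OF X cl[of a] cl[of b], rotated 2]) simp_all
    then show ?thesis by blast
  next
    case False
    then show ?thesis by (intro exI[of _ "{}"]) auto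
  qed
  define C where "C a b = (SOME C. ?sep a b C)" for a b
  have CC: "?sep a b (C a b)" for a b
    unfolding C_def by (rule someI_ex[OF ex])
  have C: "openin X (C a b) \<and> closedin X (C a b)" for a b using CC by blast
  have sep: "{x\<in>A. f x = a} \<subseteq> C a b \<and> C a b \<inter> {x\<in>A. f x = b} = {}"
    if "a \<in> topspace K" "b \<in> topspace K" "a \<noteq> b" for a b
    using CC[of a b] that by blast
  define e :: "'x \<Rightarrow> 'a \<times> 'a \<Rightarrow> bool" where "e x = (\<lambda>(a, b). x \<in> C a b)" for x
  define P where "P = product_topology (\<lambda>_. discrete_topology (UNIV :: bool set)) (UNIV :: ('a \<times> 'a) set)"
  have Phaus: "Hausdorff_space P"
    unfolding P_def by (simp add: Hausdorff_space_product_topology)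
  have contP: "continuous_map X P e"
    unfolding P_def continuous_map_componentwise_UNIV
  proof
    fix i :: "'a \<times> 'a"
    obtain a b where i: "i = (a, b)" by (cases i)
    have sub: "C a b \<subseteq> topspace X" using C openin_subset by blast
    have "openin X {x \<in> topspace X. (x \<in> C a b) \<in> U}" for U :: "bool set"
    proof -
      have 1: "{x \<in> topspace X. (x \<in> C a b) \<in> U} =
          (if True \<in> U then C a b else {}) \<union> (if False \<in> U then topspace X - C a b else {})"
      proof (rule set_eqI)
        fix x
        show "x \<in> {x \<in> topspace X. (x \<in> C a b) \<in> U} \<longleftrightarrow> x \<in>
            (if True \<in> U then C a b else {}) \<union> (if False \<in> U then topspace X - C a b else {})"
          using sub by (cases "x \<in> C a b") auto
      qed
      have "openin X (C a b)" "openin X (topspace X - C a b)" using C by blast+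
      then show ?thesis unfolding 1 by (intro openin_Un) simp_all
    qed
    then show "continuous_map X (discrete_topology UNIV) (\<lambda>x. e x i)"
      unfolding continuous_map_def by (simp add: e_def i)
  qed
  define X0 where "X0 = subtopology P (e ` topspace X)"
  have topP: "topspace P = UNIV" by (simp add: P_def)
  have X0: "compact_space X0" "Hausdorff_space X0" "X0 dim_le 0"
  proof -
    show "compact_space X0"
      unfolding X0_def using X(1) contP
      by (intro compact_space_subtopology image_compactin[of X "topspace X" P e])
        (simp_all add: compact_space_def)
    show "Hausdorff_space X0" unfolding X0_def using Phaus by (rule Hausdorff_space_subtopology)
    show "X0 dim_le 0" unfolding X0_def P_def by (rule dim_le_0_subtopology[OF dim_le_0_discrete_power])
  qed
  have contX0: "continuous_map X X0 e"
    unfolding X0_def using contP by (simp add: continuous_map_in_subtopology)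
  have "compactin X0 (e ` A)"
    by (rule image_compactin[OF closedin_compact_space[OF X(1) A] contX0])
  then have A0: "closedin X0 (e ` A)"
    by (rule compactin_imp_closedin[OF X0(2)])
  have fib: "f x = f y" if "x \<in> A" "y \<in> A" "e x = e y" for x y
  proof (rule ccontr)
    assume "f x \<noteq> f y"
    then have "x \<in> C (f x) (f y)" "y \<notin> C (f x) (f y)"
      using sep[of "f x" "f y"] fA that by blast+
    moreover have "e x (f x, f y) = e y (f x, f y)" using that by simp
    ultimately show False by (simp add: e_def)
  qed
  define f0 where "f0 y = f (SOME x. x \<in> A \<and> e x = y)" for y
  have f0e: "f0 (e x) = f x" if "x \<in> A" for x
  proof -
    have "(SOME z. z \<in> A \<and> e z = e x) \<in> A \<and> e (SOME z. z \<in> A \<and> e z = e x) = e x"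
      by (rule someI[of _ x]) (use that in simp)
    then show ?thesis unfolding f0_def by (elim conjE) (rule fib[OF _ that])
  qed
  let ?XA = "subtopology X A" and ?YA = "subtopology X0 (e ` A)"
  have topXA: "topspace ?XA = A" using Asub by auto
  have topYA: "topspace ?YA = e ` A" using A0 closedin_subset by fastforce
  have cont: "continuous_map ?XA ?YA e"
    using contX0 topXA by (simp add: continuous_map_in_subtopology continuous_map_from_subtopology)
  have "compact_space ?XA"
    by (rule compact_space_subtopology[OF closedin_compact_space[OF X(1) A]])
  moreover have "Hausdorff_space ?YA" using X0(2) by (rule Hausdorff_space_subtopology)
  ultimately have "closed_map ?XA ?YA e"
    using cont continuous_imp_closed_map_gen Hausdorff_imp_kc_space by blast
  then have "quotient_map ?XA ?YA e"
    using cont by (intro continuous_closed_imp_quotient_map) (simp_all only: topXA topYA)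
  moreover have "continuous_map ?XA K (f0 \<circ> e)"
    using f by (rule continuous_map_eq) (simp add: topXA f0e)
  ultimately have "continuous_map ?YA K f0" by (rule continuous_compose_quotient_map)
  then obtain F0 where F0: "continuous_map X0 K F0" "\<forall>y\<in>e ` A. F0 y = f0 y"
    using K[unfolded dugundji_compact_def, THEN conjunct2, THEN conjunct2, rule_format,
        of X0 "e ` A" f0] X0 A0 by auto
  have "continuous_map X K (F0 \<circ> e)" using contX0 F0(1) by (rule continuous_map_compose)
  moreover have "\<forall>x\<in>A. (F0 \<circ> e) x = f x" using F0(2) f0e by simp
  ultimately show ?thesis by blast
qed


section \<open>The Banach space \<open>C(K)\<close>\<close>

text \<open>For compact \<open>K\<close> all continuous functions are bounded, so the library type
  \<^typ>\<open>'a \<Rightarrow>\<^sub>C real\<close> is \<open>C(K)\<close>. The library proves its completeness for metric domains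
  only.\<close>

instance bcontfun :: (topological_space, complete_space) complete_space
proof
  fix f :: "nat \<Rightarrow> 'a \<Rightarrow>\<^sub>C 'b"
  assume "Cauchy f"
  then have "uniformly_Cauchy_on UNIV (\<lambda>n. apply_bcontfun (f n))"
    unfolding uniformly_Cauchy_on_def Cauchy_def by (meson dist_fun_lt_imp_dist_val_lt)
  then obtain g where "uniform_limit UNIV (\<lambda>n. apply_bcontfun (f n)) g sequentially"
    using Cauchy_uniformly_convergent uniformly_convergent_on_def by blast
  then show "convergent f"
    by (metis uniform_limit_bcontfunE sequentially_bot convergentI)
qed

instance bcontfun :: (topological_space, banach) banach ..

definition regular_operator :: "(('a::topological_space \<Rightarrow>\<^sub>C real) \<Rightarrow> ('a \<Rightarrow>\<^sub>C real)) \<Rightarrow> bool"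
  where "regular_operator T \<longleftrightarrow> linear T \<and>
    (\<forall>f. (\<forall>x. 0 \<le> apply_bcontfun f x) \<longrightarrow> (\<forall>x. 0 \<le> apply_bcontfun (T f) x)) \<and>
    T (const_bcontfun 1) = const_bcontfun 1"


section \<open>Projectional resolutions of the identity\<close>

text \<open>The requirement that the space has density \<open>\<aleph>\<^sub>1\<close> is part of the definition.\<close>

definition is_PRI :: "(omega_one \<Rightarrow> 'e::banach \<Rightarrow>\<^sub>L 'e) \<Rightarrow> bool"
  where "is_PRI P \<longleftrightarrow>
    has_density (euclidean :: 'e topology) aleph_one \<and>
    (\<forall>\<alpha>. P \<alpha> o\<^sub>L P \<alpha> = P \<alpha> \<and> norm (P \<alpha>) = 1 \<and>
       separable_space (top_of_set (range (blinfun_apply (P \<alpha>))))) \<and>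
    (\<forall>\<alpha> \<beta>. \<alpha> < \<beta> \<longrightarrow> P \<alpha> = P \<alpha> o\<^sub>L P \<beta> \<and> P \<alpha> = P \<beta> o\<^sub>L P \<alpha>) \<and>
    (\<Union>\<alpha>. range (blinfun_apply (P \<alpha>))) = UNIV \<and>
    (\<forall>\<delta>. limit_ordinal \<delta> \<longrightarrow>
       range (blinfun_apply (P \<delta>)) = closure (\<Union>\<alpha>\<in>{..<\<delta>}. range (blinfun_apply (P (osucc \<alpha>)))))"


section \<open>1-Plichko spaces\<close>

text \<open>The supremum is taken in \<^typ>\<open>ennreal\<close>, where the empty supremum is \<open>0\<close>; on
  \<^typ>\<open>real\<close> it would be unspecified.\<close>

definition one_norming :: "('e::real_normed_vector \<Rightarrow>\<^sub>L real) set \<Rightarrow> bool"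
  where "one_norming Y \<longleftrightarrow>
    (\<forall>v. ennreal (norm v) \<le> (SUP y\<in>Y - {0}. ennreal (\<bar>blinfun_apply y v\<bar> / norm y)))"

definition one_plichko :: "'e::banach itself \<Rightarrow> bool"
  where "one_plichko _ \<longleftrightarrow>
    (\<exists>(X :: 'e set) Y. closure (span X) = UNIV \<and> one_norming Y \<and>
      (\<forall>y\<in>Y. countable {x \<in> X. blinfun_apply y x \<noteq> 0}))"


section \<open>Probability measures\<close>

text \<open>For real-valued operators \<^term>\<open>strong_operator_topology\<close>, the topology of pointwise
  convergence, is the weak-star topology of the dual space.\<close>

definition prob_space_topology :: "(('a::topological_space \<Rightarrow>\<^sub>C real) \<Rightarrow>\<^sub>L real) topology"
  where "prob_space_topology = subtopology strong_operator_topology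
    {\<mu>. norm \<mu> = 1 \<and> (\<forall>\<phi>. (\<forall>x. 0 \<le> apply_bcontfun \<phi> x) \<longrightarrow> 0 \<le> blinfun_apply \<mu> \<phi>)}"


section \<open>Valdivia compact spaces\<close>

definition cube :: "'i set \<Rightarrow> ('i \<Rightarrow> real) topology"
  where "cube I = product_topology (\<lambda>_. top_of_set {0..1}) I"

definition Sigma_product :: "'i set \<Rightarrow> ('i \<Rightarrow> real) set"
  where "Sigma_product I = {x \<in> topspace (cube I). countable {i \<in> I. x i \<noteq> 0}}"

definition valdivia_embeddable :: "'i set \<Rightarrow> 'b topology \<Rightarrow> bool"
  where "valdivia_embeddable I L \<longleftrightarrow>
    (\<exists>L' \<subseteq> topspace (cube I). L homeomorphic_space subtopology (cube I) L' \<and>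
      subtopology (cube I) L' closure_of (L' \<inter> Sigma_product I) = L')"

text \<open>The cardinal \<open>\<kappa>\<close> is represented by an index set. HOL cannot existentially quantify over
  types, so the index set is taken in the type of real functions on \<open>L\<close>. This is no restriction:
  by \<open>valdivia_compactI\<close> below, index sets of every other type give the same notion, because
  coordinates that coincide on \<open>L\<close> can be identified.\<close>

definition valdivia_compact :: "'b topology \<Rightarrow> bool"
  where "valdivia_compact L \<longleftrightarrow> compact_space L \<and> Hausdorff_space L \<and>
    (\<exists>I :: ('b \<Rightarrow> real) set. valdivia_embeddable I L)"

lemma topspace_cube: "topspace (cube I) = (\<Pi>\<^sub>E i\<in>I. {0..1})"
  by (simp add: cube_def)

theorem valdivia_compactI:
  fixes L :: "'b topology" and I :: "'i set"
  assumes L: "compact_space L" "Hausdorff_space L" and emb: "valdivia_embeddable I L"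
  shows "valdivia_compact L"
proof -
  obtain L' where sub: "L' \<subseteq> topspace (cube I)"
    and hom: "L homeomorphic_space subtopology (cube I) L'"
    and dense: "subtopology (cube I) L' closure_of (L' \<inter> Sigma_product I) = L'"
    using emb unfolding valdivia_embeddable_def by blast
  let ?T = "subtopology (cube I) L'"
  have topT: "topspace ?T = L'" using sub by auto
  obtain h where h: "homeomorphic_map L ?T h"
    using hom homeomorphic_space by blast
  have hcont: "continuous_map L (cube I) h"
    using h homeomorphic_imp_continuous_map continuous_map_in_subtopology by blast
  have hL: "h ` topspace L = L'"
    using h homeomorphic_imp_surjective_map topT by metis
  define c where "c i = (\<lambda>p. h p i)" for i
  define J where "J = c ` I"
  define r where "r j = (SOME i. i \<in> I \<and> c i = j)" for j
  have r: "r j \<in> I" "c (r j) = j" if "j \<in> J" for j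
  proof -
    have "\<exists>i. i \<in> I \<and> c i = j" using that by (auto simp: J_def)
    from someI_ex[OF this] show "r j \<in> I" "c (r j) = j" by (simp_all add: r_def)
  qed
  define q where "q x = (\<lambda>j\<in>J. x (r j))" for x :: "'i \<Rightarrow> real"
  have qcont: "continuous_map (cube I) (cube J) q"
    unfolding cube_def q_def
    by (rule continuous_map_componentwise[THEN iffD2])
      (use r in \<open>auto intro!: continuous_map_product_projection\<close>)
  have qinj: "inj_on q L'"
  proof (rule inj_onI)
    fix x y assume xy: "x \<in> L'" "y \<in> L'" "q x = q y"
    obtain a b where ab: "x = h a" "y = h b" using xy hL by auto
    show "x = y"
    proof (rule PiE_ext)
      show "x \<in> (\<Pi>\<^sub>E i\<in>I. {0..1})" "y \<in> (\<Pi>\<^sub>E i\<in>I. {0..1})"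
        using xy sub by (auto simp: topspace_cube)
      fix i assume "i \<in> I"
      then have J: "c i \<in> J" by (simp add: J_def)
      have "x (r (c i)) = y (r (c i))"
        using fun_cong[OF xy(3), of "c i"] J by (simp add: q_def)
      moreover have "c (r (c i)) = c i" using r J by blast
      then have "x (r (c i)) = x i" "y (r (c i)) = y i"
        unfolding ab c_def by metis+
      ultimately show "x i = y i" by simp
    qed
  qed
  let ?L'' = "q ` L'"
  let ?S = "subtopology (cube J) ?L''"
  have sub'': "?L'' \<subseteq> topspace (cube J)"
    using qcont sub continuous_map_image_subset_topspace by blast
  have topS: "topspace ?S = ?L''" using sub'' by auto
  have qT: "continuous_map ?T ?S q"
    using qcont topT by (simp add: continuous_map_in_subtopology continuous_map_from_subtopology)
  have "compact_space ?T" using L(1) hom homeomorphic_compact_space by blast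
  moreover have "Hausdorff_space ?S"
    unfolding cube_def by (intro Hausdorff_space_subtopology)
      (simp add: Hausdorff_space_product_topology Hausdorff_space_subtopology)
  ultimately have qhom: "homeomorphic_map ?T ?S q"
    using qT qinj topT topS by (intro continuous_imp_homeomorphic_map) auto
  have Lhom: "L homeomorphic_space ?S"
    using hom qhom homeomorphic_map_imp_homeomorphic_space homeomorphic_space_trans by blast
  have Sig: "q ` (L' \<inter> Sigma_product I) \<subseteq> ?L'' \<inter> Sigma_product J"
  proof
    fix z assume "z \<in> q ` (L' \<inter> Sigma_product I)"
    then obtain x where x: "x \<in> L'" "countable {i \<in> I. x i \<noteq> 0}" "z = q x"
      by (auto simp: Sigma_product_def)
    have "{j \<in> J. z j \<noteq> 0} \<subseteq> c ` {i \<in> I. x i \<noteq> 0}"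
      using r by (force simp: x(3) q_def)
    then have "countable {j \<in> J. z j \<noteq> 0}"
      using x(2) countable_image countable_subset by blast
    then show "z \<in> ?L'' \<inter> Sigma_product J"
      using x sub'' by (auto simp: Sigma_product_def)
  qed
  have "?L'' = q ` (?T closure_of (L' \<inter> Sigma_product I))" using dense by simp
  also have "\<dots> \<subseteq> ?S closure_of (q ` (L' \<inter> Sigma_product I))"
    using qT continuous_map_image_closure_subset by blast
  also have "\<dots> \<subseteq> ?S closure_of (?L'' \<inter> Sigma_product J)"
    using Sig by (rule closure_of_mono)
  finally have "?S closure_of (?L'' \<inter> Sigma_product J) = ?L''"
    using closure_of_subset_topspace[of ?S] topS by blast
  then have "valdivia_embeddable J L"
    unfolding valdivia_embeddable_def using sub'' Lhom by blast
  then show ?thesis using L unfolding valdivia_compact_def by blast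
qed

end

theory Submission
  imports Defs
begin

text \<open>
  Choose continuous functions \<open>g i\<close> on \<open>K\<close>, indexed by \<open>i < \<omega>\<^sub>1\<close>, such that for any
  \<open>x \<noteq> y\<close> some \<open>g i\<close> is negative at \<open>x\<close> and exceeds \<open>1\<close> at \<open>y\<close>. A point \<open>x\<close>
  is then encoded by random binary digits: independently for each \<open>i\<close>, the \<open>i\<close>-th digit is \<open>1\<close>
  with probability \<open>g i x\<close> clamped to \<open>[0,1]\<close>. Digit \<open>1\<close> occurs only if \<open>g i x \<ge> 0\<close> and
  digit \<open>0\<close> only if \<open>g i x \<le> 1\<close>, so the digit sequence determines \<open>x\<close>. Decoding is a
  continuous map from a closed subset of the Cantor cube onto \<open>K\<close>, and since \<open>K\<close> is a Dugundji
  compact, it extends to a continuous map \<open>pt\<close> on the whole cube (\<open>dugundji_digit_map\<close>).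

  The extension gives a meaning to truncated digit sequences. For a set \<open>S\<close> of indices let
  \<open>average S \<phi> x\<close> be the expectation of \<open>\<phi> (pt A)\<close>, where \<open>A\<close> consists of the random digits of
  \<open>x\<close> inside \<open>S\<close> and of zeros elsewhere. This is a regular operator, and its values depend on
  \<open>x\<close> only through the functions \<open>g i\<close> with \<open>i \<in> S\<close>. Suppose that \<open>S\<close> is self-determined,
  which means that each \<open>g i (pt A)\<close> with \<open>i \<in> S\<close> depends only on the digits in \<open>S\<close>. If \<open>\<phi>\<close> is
  itself a function of the \<open>g i\<close> with \<open>i \<in> S\<close>, then deleting the digits outside \<open>S\<close> does not change
  \<open>\<phi> (pt A)\<close>, and \<open>average S \<phi> = \<phi>\<close> (\<open>average_eq\<close>). Hence \<open>average S\<close> is a regular projection onto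
  the algebra \<open>determined_by S\<close>.

  A continuous function on the cube depends on countably many digits. Closing the initial segments
  of \<open>\<omega>\<^sub>1\<close> under these countable dependencies gives countable self-determined sets \<open>S \<alpha>\<close> that
  increase continuously and cover \<open>\<omega>\<^sub>1\<close>. Their algebras form a continuous chain of separable
  subspaces with union \<open>C(K)\<close>, each one the range of a regular projection.

  These projections need not commute. Only their restrictions to the next member of the chain are
  used: composing them transfinitely, with limits at limit ordinals, yields commuting contractive
  projections onto the same subspaces (\<open>coherent_projections\<close>). A contraction that fixes the constant
  \<open>1\<close> is positive, so the new projections are regular.

  Finally, let \<open>X\<close> consist of normalised differences \<open>d - P \<alpha> d\<close> with \<open>d\<close> from a countable dense
  subset of \<open>range (P (osucc \<alpha>))\<close>, together with countably many vectors that are dense in the first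
  range. A functional \<open>y\<close> with \<open>y o\<^sub>L P \<beta> = y\<close> vanishes on all
  differences with \<open>\<alpha> \<ge> \<beta>\<close>, hence has countable support in \<open>X\<close>. Such functionals are
  \<open>1\<close>-norming, and the probability measures among them are weak-star dense in \<open>P(K)\<close>, because
  \<open>\<mu> o\<^sub>L P \<beta>\<close> agrees with \<open>\<mu>\<close> on \<open>range (P \<beta>)\<close>.
\<close>

section \<open>Countable ordinals\<close>

lemma osucc_leI: "\<alpha> < \<beta> \<Longrightarrow> osucc \<alpha> \<le> \<beta>"
  unfolding osucc_def by (rule Least_le)

lemma less_osucc_iff: "\<alpha> < osucc \<beta> \<longleftrightarrow> \<alpha> \<le> \<beta>"
  using less_osucc[of \<beta>] osucc_leI[of \<beta> \<alpha>] by (meson leD le_less_trans not_le)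

lemma ordinal_cases [case_names least succ limit]:
  obtains "\<And>\<beta>. \<alpha> \<le> \<beta>" | \<beta> where "\<alpha> = osucc \<beta>" | "limit_ordinal \<alpha>"
proof (cases "\<exists>\<beta>. \<beta> < \<alpha>")
  case True
  show thesis
  proof (cases "\<exists>\<beta><\<alpha>. \<alpha> \<le> osucc \<beta>")
    case True
    then show thesis using osucc_leI that(2) by (metis antisym)
  next
    case False
    then show thesis using True that(3) unfolding limit_ordinal_def by (meson not_le)
  qed
qed (use that(1) in \<open>auto simp: not_less\<close>)

lemma countable_bounded_omega_one:
  assumes "countable A"
  obtains \<beta> :: omega_one where "A \<subseteq> {..<\<beta>}"
proof -
  have "countable (\<Union>\<alpha>\<in>A. {\<gamma>. \<gamma> < osucc \<alpha>})"
    using assms countable_below_omega_one by blast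
  then obtain \<beta> where "\<beta> \<notin> (\<Union>\<alpha>\<in>A. {\<gamma>. \<gamma> < osucc \<alpha>})"
    using uncountable_omega_one by (metis UNIV_eq_I)
  then have "A \<subseteq> {..<\<beta>}" by (auto simp: less_osucc_iff)
  then show thesis by (rule that)
qed

section \<open>Pointwise limits of contractions\<close>

text \<open>The operators \<open>T b\<close> need to be Cauchy along \<open>F\<close> only pointwise; the uniform bound \<open>1\<close> passes to
  the limit and makes it continuous. Both limit processes below are of this kind: averages over
  growing finite sets of digits, and transfinite compositions of projections.\<close>

lemma pointwise_limit_of_contractions:
  fixes T :: "'b \<Rightarrow> 'e::real_normed_vector \<Rightarrow>\<^sub>L 'f::banach"
  assumes F: "F \<noteq> bot" and T: "\<And>b. norm (T b) \<le> 1"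
    and Cauchy: "\<And>x \<epsilon>. \<epsilon> > 0 \<Longrightarrow> \<exists>y. \<forall>\<^sub>F b in F. dist (T b x) y < \<epsilon>"
  obtains L where "norm L \<le> 1" and "\<And>x. ((\<lambda>b. T b x) \<longlongrightarrow> blinfun_apply L x) F"
proof -
  have "\<exists>l. ((\<lambda>b. T b x) \<longlongrightarrow> l) F" for x
  proof -
    have "cauchy_filter (filtermap (\<lambda>b. T b x) F)"
    proof (subst cauchy_filter_metric_filtermap, intro allI impI)
      fix \<epsilon> :: real assume "\<epsilon> > 0"
      then obtain y where y: "\<forall>\<^sub>F b in F. dist (T b x) y < \<epsilon>/2"
        using Cauchy[of "\<epsilon>/2" x] by auto
      show "\<exists>P. eventually P F \<and> (\<forall>b c. P b \<and> P c \<longrightarrow> dist (T b x) (T c x) < \<epsilon>)"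
        using y by (intro exI[of _ "\<lambda>b. dist (T b x) y < \<epsilon>/2"])
          (auto intro: dist_triangle_half_l[where y=y] simp: dist_commute)
    qed
    then obtain l where "filtermap (\<lambda>b. T b x) F \<le> nhds l"
      using cauchy_filter_complete_converges[of "filtermap (\<lambda>b. T b x) F" UNIV] F
      by (auto simp: complete_UNIV filtermap_bot_iff)
    then show ?thesis unfolding filterlim_def by blast
  qed
  then obtain l where l: "\<And>x. ((\<lambda>b. T b x) \<longlongrightarrow> l x) F" by metis
  have bound: "norm (l x) \<le> norm x" for x
  proof (rule tendsto_upperbound[OF tendsto_norm[OF l] always_eventually F], intro allI)
    show "norm (T b x) \<le> norm x" for b
      using norm_blinfun[of "T b" x] T[of b] mult_right_mono[of "norm (T b)" 1 "norm x"] by simp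
  qed
  have "bounded_linear l"
  proof (rule bounded_linear_intro[where K=1])
    show "l (x + y) = l x + l y" for x y
      using tendsto_unique[OF F l[of "x+y"]] tendsto_add[OF l[of x] l[of y]]
      by (simp add: blinfun.add_right)
    show "l (r *\<^sub>R x) = r *\<^sub>R l x" for r x
      using tendsto_unique[OF F l[of "r *\<^sub>R x"]] tendsto_scaleR[OF tendsto_const l[of x]]
      by (simp add: blinfun.scaleR_right)
    show "norm (l x) \<le> norm x * 1" for x using bound by simp
  qed
  then have ap: "blinfun_apply (Blinfun l) = l" by (rule bounded_linear_Blinfun_apply)
  show thesis
  proof
    show "norm (Blinfun l) \<le> 1" by (rule norm_blinfun_bound) (use bound in \<open>auto simp: ap\<close>)
    show "((\<lambda>b. T b x) \<longlongrightarrow> blinfun_apply (Blinfun l) x) F" for x using l by (simp add: ap)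
  qed
qed

section \<open>Coherent projections onto the members of a chain\<close>

text \<open>The filter along which one passes to the limit in \<open>J\<close>. For an initial segment \<open>J\<close> of
  \<open>\<omega>\<^sub>1\<close> without greatest element it plays the part of \<open>at_left\<close> at the supremum of \<open>J\<close>, or of \<open>at_top\<close> if
  \<open>J\<close> is everything.\<close>

definition final_segments :: "'b::order set \<Rightarrow> 'b filter"
  where "final_segments J = (INF \<gamma>\<in>J. principal {\<gamma>'\<in>J. \<gamma> \<le> \<gamma>'})"

lemma eventually_final_segments:
  fixes J :: "'b::linorder set"
  assumes "J \<noteq> {}"
  shows "eventually P (final_segments J) \<longleftrightarrow> (\<exists>\<gamma>\<in>J. \<forall>\<gamma>'\<in>J. \<gamma> \<le> \<gamma>' \<longrightarrow> P \<gamma>')"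
  unfolding final_segments_def
proof (subst eventually_INF_base)
  fix a b assume ab: "a \<in> J" "b \<in> J"
  then have "max a b \<in> J" by (simp add: max_def)
  moreover have "{\<gamma>\<in>J. max a b \<le> \<gamma>} \<subseteq> {\<gamma>\<in>J. a \<le> \<gamma>} \<inter> {\<gamma>\<in>J. b \<le> \<gamma>}" by auto
  ultimately show "\<exists>x\<in>J. principal {\<gamma>\<in>J. x \<le> \<gamma>} \<le> inf (principal {\<gamma>\<in>J. a \<le> \<gamma>}) (principal {\<gamma>\<in>J. b \<le> \<gamma>})"
    by (metis inf_principal principal_le_iff)
qed (use assms in \<open>auto simp: eventually_principal\<close>)

lemma final_segments_neq_bot: "J \<noteq> {} \<Longrightarrow> final_segments (J :: 'b::linorder set) \<noteq> bot"
  by (subst trivial_limit_def, subst eventually_final_segments) auto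

locale projection_chain =
  fixes C :: "omega_one \<Rightarrow> 'e::banach set" and R :: "omega_one \<Rightarrow> 'e \<Rightarrow>\<^sub>L 'e"
  assumes mono: "\<alpha> \<le> \<beta> \<Longrightarrow> C \<alpha> \<subseteq> C \<beta>"
    and limit: "limit_ordinal \<delta> \<Longrightarrow> C \<delta> \<subseteq> closure (\<Union>\<alpha>\<in>{..<\<delta>}. C \<alpha>)"
    and exhausts: "(\<Union>\<alpha>. C \<alpha>) = UNIV"
    and R_in: "R \<alpha> x \<in> C \<alpha>"
    and R_id: "x \<in> C \<alpha> \<Longrightarrow> R \<alpha> x = x"
    and R_norm: "norm (R \<alpha>) \<le> 1"
begin

lemma closed_C: "closed (C \<alpha>)"
proof -
  have "C \<alpha> = {x. R \<alpha> x = x}" using R_in R_id by (auto, metis)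
  then show ?thesis by (auto intro!: closed_Collect_eq continuous_intros)
qed

text \<open>The transfinite composition of the \<open>R \<gamma>\<close> with \<open>\<gamma> \<ge> \<alpha>\<close> is characterised by the single-step
  rule in the last conjunct: on \<open>C (osucc \<gamma>)\<close> one may apply \<open>R \<gamma>\<close> first. The set \<open>J\<close>
  is the stage of the construction up to which this rule is required.\<close>

definition coherent :: "omega_one \<Rightarrow> omega_one set \<Rightarrow> ('e \<Rightarrow>\<^sub>L 'e) \<Rightarrow> bool"
  where "coherent \<alpha> J T \<longleftrightarrow> norm T \<le> 1 \<and> (\<forall>x. T x \<in> C \<alpha>) \<and> (\<forall>x\<in>C \<alpha>. T x = x) \<and>
    (\<forall>\<gamma> x. \<alpha> \<le> \<gamma> \<longrightarrow> osucc \<gamma> \<in> J \<longrightarrow> x \<in> C (osucc \<gamma>) \<longrightarrow> T x = T (R \<gamma> x))"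

lemma coherent_mono: "coherent \<alpha> J T \<Longrightarrow> J' \<subseteq> J \<Longrightarrow> coherent \<alpha> J' T"
  unfolding coherent_def by blast

text \<open>The rule reduces the value at \<open>x \<in> C (osucc \<gamma>)\<close> to a value on \<open>C \<gamma>\<close>, and at a limit
  \<open>C \<gamma>\<close> is contained in the closure of the earlier members, where the operators already agree.\<close>

lemma coherent_unique:
  assumes T: "coherent \<alpha> J T" "coherent \<alpha> J T'"
    and J: "\<And>\<gamma> \<gamma>'. \<gamma> \<in> J \<Longrightarrow> \<gamma>' \<le> \<gamma> \<Longrightarrow> \<gamma>' \<in> J"
  shows "\<gamma> \<in> J \<Longrightarrow> x \<in> C \<gamma> \<Longrightarrow> T x = T' x"
proof (induction \<gamma> arbitrary: x rule: less_induct)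
  case (less \<gamma>)
  show ?case
  proof (cases "\<gamma> \<le> \<alpha>")
    case True
    then show ?thesis using T less.prems mono unfolding coherent_def by (metis subsetD)
  next
    case False
    show ?thesis
    proof (cases \<gamma> rule: ordinal_cases)
      case least
      then show ?thesis using False by blast
    next
      case (succ \<beta>)
      have \<beta>: "\<beta> < \<gamma>" "\<alpha> \<le> \<beta>" using succ less_osucc False less_osucc_iff by (auto simp: not_le)
      then have "T (R \<beta> x) = T' (R \<beta> x)"
        using less.IH R_in J less.prems(1) less_imp_le by metis
      then show ?thesis using T \<beta> less.prems succ unfolding coherent_def by metis
    next
      case limit
      have "closed {x. T x = T' x}" by (auto intro!: closed_Collect_eq continuous_intros)
      moreover have "(\<Union>\<beta>\<in>{..<\<gamma>}. C \<beta>) \<subseteq> {x. T x = T' x}"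
        using less.IH J less.prems(1) by (auto dest: less_imp_le)
      ultimately have "closure (\<Union>\<beta>\<in>{..<\<gamma>}. C \<beta>) \<subseteq> {x. T x = T' x}"
        by (rule closure_minimal[rotated])
      then show ?thesis using projection_chain.limit[OF projection_chain_axioms limit] less.prems(2)
        by blast
    qed
  qed
qed

text \<open>Operators constructed for the stages below \<open>J\<close> agree where they should by uniqueness, so they
  converge along \<open>J\<close>, being eventually constant on each \<open>C \<gamma>\<close>. They are composed with a contraction
  \<open>Q\<close> into the closure of the union of these \<open>C \<gamma>\<close> to have a limit on the whole space. A limit
  ordinal \<open>\<delta>\<close> is reached with \<open>Q = R \<delta>\<close>, and \<open>\<omega>\<^sub>1\<close> with the identity.\<close>

lemma coherent_glue:
  assumes J: "\<And>\<gamma> \<gamma>'. \<gamma> \<in> J \<Longrightarrow> \<gamma>' \<le> \<gamma> \<Longrightarrow> \<gamma>' \<in> J" "\<And>\<gamma>. \<gamma> \<in> J \<Longrightarrow> osucc \<gamma> \<in> J" "\<alpha> \<in> J"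
    and Q: "norm Q \<le> 1" "\<And>x. blinfun_apply Q x \<in> closure (\<Union>\<gamma>\<in>J. C \<gamma>)"
      "\<And>\<gamma> x. \<gamma> \<in> J \<Longrightarrow> x \<in> C \<gamma> \<Longrightarrow> Q x = x"
    and ex: "\<And>\<gamma>. \<gamma> \<in> J \<Longrightarrow> \<alpha> \<le> \<gamma> \<Longrightarrow> \<exists>T. coherent \<alpha> {..\<gamma>} T"
  shows "\<exists>T. coherent \<alpha> J T"
proof -
  obtain T where T: "\<And>\<gamma>. \<gamma> \<in> J \<Longrightarrow> \<alpha> \<le> \<gamma> \<Longrightarrow> coherent \<alpha> {..\<gamma>} (T \<gamma>)" using ex by metis
  define J' where "J' = {\<gamma>\<in>J. \<alpha> \<le> \<gamma>}"
  have J': "J' \<noteq> {}" using J(3) by (auto simp: J'_def)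
  let ?F = "final_segments J'"
  have stable: "T \<gamma> x = T \<gamma>' x" if "\<gamma> \<in> J'" "\<gamma>' \<in> J'" "\<gamma> \<le> \<gamma>'" "x \<in> C \<gamma>" for \<gamma> \<gamma>' x
    by (rule coherent_unique[of \<alpha> "{..\<gamma>}" _ _ \<gamma>])
      (use that T coherent_mono in \<open>auto simp: J'_def\<close>, metis atMost_subset_iff coherent_mono)
  have ev: "\<forall>\<^sub>F \<gamma>' in ?F. T \<gamma>' x = T \<gamma> x" if "\<gamma> \<in> J'" "x \<in> C \<gamma>" for \<gamma> x
    using stable that by (subst eventually_final_segments[OF J']) metis
  define U where "U \<gamma> = (if \<gamma> \<in> J' then T \<gamma> o\<^sub>L Q else 0)" for \<gamma>
  have evU: "\<forall>\<^sub>F \<gamma>' in ?F. U \<gamma>' x = T \<gamma>' (Q x)" for x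
    by (subst eventually_final_segments[OF J']) (use J' in \<open>auto simp: U_def\<close>)
  have above: "\<exists>\<gamma>'\<in>J'. \<gamma> \<le> \<gamma>'" if "\<gamma> \<in> J" for \<gamma>
    using that J(3) unfolding J'_def by (metis (mono_tags, lifting) linear mem_Collect_eq order_refl)
  have normU: "norm (U \<gamma>) \<le> 1" for \<gamma>
  proof (cases "\<gamma> \<in> J'")
    case True
    then have "norm (T \<gamma>) \<le> 1" using T by (auto simp: J'_def coherent_def)
    then have "norm (T \<gamma> o\<^sub>L Q) \<le> 1"
      using norm_blinfun_compose[of "T \<gamma>" Q] Q(1) mult_mono[of "norm (T \<gamma>)" 1 "norm Q" 1] by auto
    then show ?thesis using True by (simp add: U_def)
  qed (simp add: U_def)
  obtain L where L: "norm L \<le> 1" "\<And>x. ((\<lambda>\<gamma>. U \<gamma> x) \<longlongrightarrow> blinfun_apply L x) ?F"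
  proof (rule pointwise_limit_of_contractions[OF final_segments_neq_bot[OF J'] normU])
    fix x and \<epsilon> :: real assume "\<epsilon> > 0"
    then obtain \<gamma> z where z: "\<gamma> \<in> J" "z \<in> C \<gamma>" "dist z (Q x) < \<epsilon>"
      using Q(2)[of x] unfolding closure_approachable by blast
    obtain \<gamma>' where g: "\<gamma>' \<in> J'" "\<gamma> \<le> \<gamma>'" using above z(1) by blast
    then have zC: "z \<in> C \<gamma>'" using mono z by blast
    show "\<exists>y. \<forall>\<^sub>F b in ?F. dist (U b x) y < \<epsilon>"
    proof (intro exI)
      have near: "dist (T b (Q x)) (T b z) < \<epsilon>" if "norm (T b) \<le> 1" for b
      proof -
        have "dist (T b (Q x)) (T b z) \<le> norm (T b) * norm (Q x - z)"
          by (metis blinfun.diff_right dist_norm norm_blinfun)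
        also have "\<dots> \<le> 1 * norm (Q x - z)" using that by (intro mult_right_mono) auto
        also have "\<dots> < \<epsilon>" using z(3) by (simp add: dist_norm norm_minus_commute)
        finally show ?thesis .
      qed
      have "\<forall>\<^sub>F b in ?F. norm (T b) \<le> 1"
        by (subst eventually_final_segments[OF J'])
          (use J' T in \<open>auto simp: J'_def coherent_def\<close>)
      then show "\<forall>\<^sub>F b in ?F. dist (U b x) (T \<gamma>' z) < \<epsilon>"
        using evU[of x] ev[OF g(1) zC]
        by eventually_elim (metis near)
    qed
  qed (rule that)
  have lim: "L x = T \<gamma> x" if "\<gamma> \<in> J'" "x \<in> C \<gamma>" for \<gamma> x
  proof -
    have "\<gamma> \<in> J" using that by (simp add: J'_def)
    then have Qx: "Q x = x" using Q(3) that by blast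
    have "\<forall>\<^sub>F \<gamma>' in ?F. U \<gamma>' x = T \<gamma> x"
      using evU[of x] ev[OF that] by eventually_elim (simp add: Qx)
    then have "((\<lambda>\<gamma>. U \<gamma> x) \<longlongrightarrow> T \<gamma> x) ?F" by (rule tendsto_eventually)
    then show ?thesis using L(2)[of x] tendsto_unique final_segments_neq_bot[OF J'] by blast
  qed
  have "coherent \<alpha> J L"
    unfolding coherent_def
  proof (intro conjI allI impI ballI L(1))
    fix x
    have "\<forall>\<^sub>F \<gamma> in ?F. U \<gamma> x \<in> C \<alpha>"
      by (subst eventually_final_segments[OF J'])
        (use J' T in \<open>auto simp: U_def J'_def coherent_def\<close>)
    then show "L x \<in> C \<alpha>"
      using Lim_in_closed_set[OF closed_C _ final_segments_neq_bot[OF J'] L(2)] by blast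
  next
    fix x assume "x \<in> C \<alpha>"
    then show "L x = x" using lim[of \<alpha> x] T[of \<alpha>] J(3) by (simp add: J'_def coherent_def)
  next
    fix \<gamma> x assume \<gamma>: "\<alpha> \<le> \<gamma>" "osucc \<gamma> \<in> J" "x \<in> C (osucc \<gamma>)"
    then have s: "osucc \<gamma> \<in> J'" "R \<gamma> x \<in> C (osucc \<gamma>)"
      using less_osucc[of \<gamma>] R_in[of \<gamma> x] mono[OF less_imp_le, of \<gamma> "osucc \<gamma>"] by (auto simp: J'_def)
    then have "T (osucc \<gamma>) x = T (osucc \<gamma>) (R \<gamma> x)"
      using T[of "osucc \<gamma>"] \<gamma> by (simp add: J'_def coherent_def)
    then show "L x = L (R \<gamma> x)" using lim[OF s(1)] s(2) \<gamma>(3) by simp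
  qed
  then show ?thesis ..
qed

lemma coherent_exists_below: "\<alpha> \<le> \<beta> \<Longrightarrow> \<exists>T. coherent \<alpha> {..\<beta>} T"
proof (induction \<beta> rule: less_induct)
  case (less \<beta>)
  show ?case
  proof (cases "\<alpha> = \<beta>")
    case True
    have "coherent \<alpha> {..\<alpha>} (R \<alpha>)"
      unfolding coherent_def using R_norm R_in R_id less_osucc
      by (auto dest: leD[OF order_trans])
    then show ?thesis using True by blast
  next
    case False
    then have less': "\<alpha> < \<beta>" using less.prems by simp
    show ?thesis
    proof (cases \<beta> rule: ordinal_cases)
      case least
      then show ?thesis using less' leD by blast
    next
      case (succ \<gamma>)
      then have \<gamma>: "\<alpha> \<le> \<gamma>" "\<gamma> < \<beta>" using less' less_osucc less_osucc_iff by auto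
      obtain T where T: "coherent \<alpha> {..\<gamma>} T" using less.IH \<gamma> by blast
      \<comment> \<open>the new step of the composition is applied first\<close>
      have "coherent \<alpha> {..\<beta>} (T o\<^sub>L R \<gamma>)"
        unfolding coherent_def
      proof (intro conjI allI impI ballI)
        show "norm (T o\<^sub>L R \<gamma>) \<le> 1"
          using norm_blinfun_compose[of T "R \<gamma>"] T R_norm[of \<gamma>]
            mult_mono[of "norm T" 1 "norm (R \<gamma>)" 1] by (auto simp: coherent_def)
        show "(T o\<^sub>L R \<gamma>) x \<in> C \<alpha>" for x using T by (simp add: coherent_def)
        show "(T o\<^sub>L R \<gamma>) x = x" if "x \<in> C \<alpha>" for x
        proof -
          have "R \<gamma> x = x" using that mono[OF \<gamma>(1)] R_id by blast
          then show ?thesis using T that by (simp add: coherent_def)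
        qed
        fix \<eta> x assume \<eta>: "\<alpha> \<le> \<eta>" "osucc \<eta> \<in> {..\<beta>}" "x \<in> C (osucc \<eta>)"
        then have "\<eta> \<le> \<gamma>" using succ less_osucc[of \<eta>] less_osucc_iff by (metis atMost_iff order_less_le_trans)
        show "(T o\<^sub>L R \<gamma>) x = (T o\<^sub>L R \<gamma>) (R \<eta> x)"
        proof (cases "\<eta> = \<gamma>")
          case True
          then show ?thesis using R_id R_in by simp
        next
          case False
          then have lt: "osucc \<eta> \<le> \<gamma>" using \<open>\<eta> \<le> \<gamma>\<close> osucc_leI by simp
          then have "R \<gamma> x = x" "R \<gamma> (R \<eta> x) = R \<eta> x"
            using mono \<eta>(3) R_id R_in \<open>\<eta> \<le> \<gamma>\<close> by blast+
          then show ?thesis using T \<eta> lt by (simp add: coherent_def)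
        qed
      qed
      then show ?thesis by blast
    next
      case limit
      have "\<exists>T. coherent \<alpha> {..<\<beta>} T"
      proof (rule coherent_glue[where Q="R \<beta>"])
        show "R \<beta> x \<in> closure (\<Union>\<gamma>\<in>{..<\<beta>}. C \<gamma>)" for x
          using projection_chain.limit[OF projection_chain_axioms limit] R_in by blast
        show "R \<beta> x = x" if "\<gamma> \<in> {..<\<beta>}" "x \<in> C \<gamma>" for \<gamma> x
          using that mono[OF less_imp_le] by (intro R_id) blast
        show "\<exists>T. coherent \<alpha> {..\<gamma>} T" if "\<gamma> \<in> {..<\<beta>}" "\<alpha> \<le> \<gamma>" for \<gamma>
          using that less.IH by simp
        show "osucc \<gamma> \<in> {..<\<beta>}" if "\<gamma> \<in> {..<\<beta>}" for \<gamma>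
          using that limit by (simp add: limit_ordinal_def)
      qed (use less' R_norm in auto)
      \<comment> \<open>a limit ordinal is not a successor, so the stage \<open>{..\<beta>}\<close> imposes no further step\<close>
      moreover have "osucc \<gamma> < \<beta>" if "osucc \<gamma> \<le> \<beta>" for \<gamma>
        using limit that less_osucc[of \<gamma>] by (auto simp: limit_ordinal_def)
      ultimately show ?thesis by (auto simp: coherent_def)
    qed
  qed
qed

text \<open>Commutation comes from uniqueness: for \<open>\<alpha> \<le> \<beta>\<close> the operator \<open>P \<alpha> o\<^sub>L P \<beta>\<close> obeys the rule
  that characterises \<open>P \<alpha>\<close>.\<close>

theorem coherent_projections:
  obtains P :: "omega_one \<Rightarrow> 'e \<Rightarrow>\<^sub>L 'e"
  where "\<And>\<alpha>. norm (P \<alpha>) \<le> 1" "\<And>\<alpha>. range (P \<alpha>) = C \<alpha>" "\<And>\<alpha> x. x \<in> C \<alpha> \<Longrightarrow> P \<alpha> x = x"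
    "\<And>\<alpha> \<beta>. \<alpha> \<le> \<beta> \<Longrightarrow> P \<alpha> o\<^sub>L P \<beta> = P \<alpha>" "\<And>\<alpha> \<beta>. \<alpha> \<le> \<beta> \<Longrightarrow> P \<beta> o\<^sub>L P \<alpha> = P \<alpha>"
proof -
  have "\<exists>T. coherent \<alpha> UNIV T" for \<alpha>
    by (rule coherent_glue[where Q=id_blinfun])
      (simp_all add: exhausts norm_blinfun_id_le coherent_exists_below)
  then obtain P where P: "\<And>\<alpha>. coherent \<alpha> UNIV (P \<alpha>)" by metis
  have id: "x \<in> C \<alpha> \<Longrightarrow> P \<alpha> x = x" and into: "P \<alpha> x \<in> C \<alpha>" and norm: "norm (P \<alpha>) \<le> 1" for \<alpha> x
    using P unfolding coherent_def by auto
  have step: "P \<alpha> x = P \<alpha> (R \<gamma> x)" if "\<alpha> \<le> \<gamma>" "x \<in> C (osucc \<gamma>)" for \<alpha> \<gamma> x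
    using P that unfolding coherent_def by auto
  have "P \<alpha> o\<^sub>L P \<beta> = P \<alpha>" if le: "\<alpha> \<le> \<beta>" for \<alpha> \<beta>
  proof -
    have "coherent \<alpha> UNIV (P \<alpha> o\<^sub>L P \<beta>)"
      unfolding coherent_def
    proof (intro conjI allI impI ballI)
      show "norm (P \<alpha> o\<^sub>L P \<beta>) \<le> 1"
        using norm_blinfun_compose[of "P \<alpha>" "P \<beta>"] norm[of \<alpha>] norm[of \<beta>]
            mult_mono[of "norm (P \<alpha>)" 1 "norm (P \<beta>)" 1] by auto
      show "(P \<alpha> o\<^sub>L P \<beta>) x \<in> C \<alpha>" for x using into by simp
      show "(P \<alpha> o\<^sub>L P \<beta>) x = x" if "x \<in> C \<alpha>" for x
        using that mono[OF le] id by (simp add: subset_iff)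
      fix \<gamma> x assume \<gamma>: "\<alpha> \<le> \<gamma>" "x \<in> C (osucc \<gamma>)"
      show "(P \<alpha> o\<^sub>L P \<beta>) x = (P \<alpha> o\<^sub>L P \<beta>) (R \<gamma> x)"
      proof (cases "\<beta> \<le> \<gamma>")
        case True
        then show ?thesis using step \<gamma>(2) by simp
      next
        case False
        then have "osucc \<gamma> \<le> \<beta>" "\<gamma> \<le> \<beta>" by (auto intro: osucc_leI)
        then have "x \<in> C \<beta>" "R \<gamma> x \<in> C \<beta>" using mono \<gamma>(2) R_in by blast+
        then show ?thesis using id step[OF \<gamma>] by simp
      qed
    qed
    then have "(P \<alpha> o\<^sub>L P \<beta>) x = P \<alpha> x" for x
      using coherent_unique[of \<alpha> UNIV _ "P \<alpha>"] P exhausts by blast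
    then show ?thesis by (intro blinfun_eqI) simp
  qed
  moreover have "P \<beta> o\<^sub>L P \<alpha> = P \<alpha>" if "\<alpha> \<le> \<beta>" for \<alpha> \<beta>
    using mono[OF that] into id by (intro blinfun_eqI) (simp add: subset_iff)
  moreover have "range (P \<alpha>) = C \<alpha>" for \<alpha>
    using into id by (auto, metis rangeI)
  ultimately show thesis using norm id by (intro that[of P])
qed

end

section \<open>Averaging over random digits\<close>

lemma linear_apply_bcontfun: "linear (\<lambda>\<phi>::'a::topological_space \<Rightarrow>\<^sub>C real. apply_bcontfun \<phi> x)"
  by (rule linearI) simp_all

lemma apply_bcontfun_le_norm: "\<bar>apply_bcontfun \<phi> x\<bar> \<le> norm (\<phi> :: 'a::topological_space \<Rightarrow>\<^sub>C real)"
  using norm_bounded[of \<phi> x] by simp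

definition point_evaluation :: "'a::topological_space \<Rightarrow> ('a \<Rightarrow>\<^sub>C real) \<Rightarrow>\<^sub>L real"
  where "point_evaluation x = Blinfun (\<lambda>\<phi>. apply_bcontfun \<phi> x)"

lemma point_evaluation_apply [simp]: "point_evaluation x \<phi> = apply_bcontfun \<phi> x"
  and norm_point_evaluation_le: "norm (point_evaluation x) \<le> 1"
proof -
  have "bounded_linear (\<lambda>\<phi>::'a \<Rightarrow>\<^sub>C real. apply_bcontfun \<phi> x)"
    by (rule bounded_linear_intro[where K=1]) (simp_all add: apply_bcontfun_le_norm)
  then show ap: "point_evaluation x \<phi> = apply_bcontfun \<phi> x" for \<phi>
    unfolding point_evaluation_def by (simp add: bounded_linear_Blinfun_apply)
  show "norm (point_evaluation x) \<le> 1"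
    by (rule norm_blinfun_bound) (simp_all add: ap apply_bcontfun_le_norm)
qed

lemma apply_bcontfun_sum:
  fixes f :: "'b \<Rightarrow> 'a::topological_space \<Rightarrow>\<^sub>C real"
  shows "apply_bcontfun (sum f A) x = (\<Sum>a\<in>A. apply_bcontfun (f a) x)"
  using linear_sum[OF linear_apply_bcontfun] by blast

text \<open>Rational linear combinations, written as lists of coefficients and vectors, are countably many.\<close>

lemma countable_dense_in_span:
  fixes W :: "'e::real_normed_vector set"
  assumes "countable W"
  obtains D where "countable D" "span W \<subseteq> closure D"
proof
  define comb where "comb l = (\<Sum>(q, w)\<leftarrow>l. real_of_rat q *\<^sub>R w)" for l :: "(rat \<times> 'e) list"
  let ?D = "comb ` lists (UNIV \<times> W)"
  have comb_Cons: "comb ((q, w) # l) = real_of_rat q *\<^sub>R w + comb l" for q w l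
    by (simp add: comb_def)
  show "countable ?D" using assms by (intro countable_image countable_lists) auto
  show "span W \<subseteq> closure ?D"
  proof
    fix x assume "x \<in> span W"
    then show "x \<in> closure ?D"
    proof (induction rule: span_induct_alt)
      case base
      have "comb [] \<in> ?D" by (intro imageI) simp
      then have "comb [] \<in> closure ?D" using closure_subset by blast
      then show ?case by (simp add: comb_def)
    next
      case (step c w y)
      show ?case
        unfolding closure_approachable
      proof (intro allI impI)
        fix \<epsilon> :: real assume "\<epsilon> > 0"
        then obtain l where l: "l \<in> lists (UNIV \<times> W)" "dist (comb l) y < \<epsilon>/2"
          using step.IH half_gt_zero[of \<epsilon>] unfolding closure_approachable by blast
        obtain q where q: "c < real_of_rat q" "real_of_rat q < c + \<epsilon> / (2 * (norm w + 1))"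
          using of_rat_dense[of c "c + \<epsilon> / (2 * (norm w + 1))"] \<open>\<epsilon> > 0\<close>
          by (auto simp: add_nonneg_pos)
        have "\<bar>real_of_rat q - c\<bar> * norm w \<le> (\<epsilon> / (2 * (norm w + 1))) * norm w"
          using q by (intro mult_right_mono) auto
        also have "\<dots> \<le> \<epsilon>/2"
          using \<open>\<epsilon> > 0\<close> norm_ge_zero[of w]
          by (simp add: divide_le_eq algebra_simps add_pos_nonneg)
        finally have "norm ((real_of_rat q - c) *\<^sub>R w) \<le> \<epsilon>/2" by simp
        moreover have "norm (comb l - y) < \<epsilon>/2" using l by (simp add: dist_norm)
        moreover have eq: "comb ((q, w) # l) - (c *\<^sub>R w + y) = (real_of_rat q - c) *\<^sub>R w + (comb l - y)"
          by (simp add: comb_Cons algebra_simps)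
        ultimately have "dist (comb ((q, w) # l)) (c *\<^sub>R w + y) < \<epsilon>"
          unfolding dist_norm eq using norm_triangle_ineq[of "(real_of_rat q - c) *\<^sub>R w" "comb l - y"]
          by linarith
        moreover have "comb ((q, w) # l) \<in> ?D" using l step.hyps by (intro imageI) simp
        ultimately show "\<exists>z\<in>?D. dist z (c *\<^sub>R w + y) < \<epsilon>" by blast
      qed
    qed
  qed
qed

text \<open>A sequence of binary digits is represented by the set of the indices with digit \<open>1\<close>. The set \<open>A\<close>
  is an admissible expansion of \<open>x\<close> if \<open>g i x \<ge> 0\<close> for \<open>i \<in> A\<close> and \<open>g i x \<le> 1\<close> for \<open>i \<notin> A\<close>; when
  \<open>g i x\<close> lies in \<open>[0,1]\<close> both digits are allowed, and this overlap is what makes room for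
  probabilities that vary continuously. The map \<open>pt\<close> is defined on all digit sequences and decodes the
  admissible ones. Its continuity on the Cantor cube is stated through test functions: up to \<open>\<epsilon>\<close>,
  finitely many digits determine \<open>\<phi> (pt A)\<close>.\<close>

locale digit_map =
  fixes g :: "'i \<Rightarrow> 'a::topological_space \<Rightarrow>\<^sub>C real" and pt :: "'i set \<Rightarrow> 'a"
  assumes pt_continuous: "\<epsilon> > 0 \<Longrightarrow>
      \<exists>H. finite H \<and> (\<forall>A B. A \<inter> H = B \<inter> H \<longrightarrow>
        \<bar>apply_bcontfun (\<phi> :: 'a \<Rightarrow>\<^sub>C real) (pt A) - apply_bcontfun \<phi> (pt B)\<bar> < \<epsilon>)"
    and pt_expansion: "(\<And>i. i \<in> A \<Longrightarrow> 0 \<le> apply_bcontfun (g i) x) \<Longrightarrow>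
      (\<And>i. i \<notin> A \<Longrightarrow> apply_bcontfun (g i) x \<le> 1) \<Longrightarrow> pt A = x"
begin

definition digit_prob :: "'i \<Rightarrow> 'a \<Rightarrow> real"
  where "digit_prob i x = max 0 (min 1 (apply_bcontfun (g i) x))"

text \<open>The probability that the random digits of \<open>x\<close> in \<open>J\<close> are \<open>1\<close> exactly on \<open>A\<close>.\<close>

definition weight :: "'i set \<Rightarrow> 'i set \<Rightarrow> 'a \<Rightarrow> real"
  where "weight J A x = (\<Prod>i\<in>A. digit_prob i x) * (\<Prod>i\<in>J - A. 1 - digit_prob i x)"

lemma digit_prob_bounds: "0 \<le> digit_prob i x" "digit_prob i x \<le> 1"
  by (auto simp: digit_prob_def)

lemma weight_nonneg: "0 \<le> weight J A x"
  unfolding weight_def by (intro mult_nonneg_nonneg prod_nonneg) (auto simp: digit_prob_bounds)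

lemma weight_sum: "finite J \<Longrightarrow> (\<Sum>A\<in>Pow J. weight J A x) = 1"
  using prod_add[of J "\<lambda>i. digit_prob i x" "\<lambda>i. 1 - digit_prob i x"] by (simp add: weight_def)

lemma weight_le_1: "weight J A x \<le> 1"
  unfolding weight_def
  by (intro mult_le_one prod_le_1 prod_nonneg) (auto simp: digit_prob_bounds)

lemma weight_average_close:
  assumes "finite J"
    and "\<And>A. A \<subseteq> J \<Longrightarrow> weight J A x \<noteq> 0 \<Longrightarrow> \<bar>h A - h' A\<bar> \<le> \<epsilon>"
  shows "\<bar>(\<Sum>A\<in>Pow J. weight J A x * h A) - (\<Sum>A\<in>Pow J. weight J A x * h' A)\<bar> \<le> \<epsilon>"
proof -
  have "\<bar>(\<Sum>A\<in>Pow J. weight J A x * h A) - (\<Sum>A\<in>Pow J. weight J A x * h' A)\<bar>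
      = \<bar>\<Sum>A\<in>Pow J. weight J A x * (h A - h' A)\<bar>"
    by (simp add: sum_subtractf right_diff_distrib)
  also have "\<dots> \<le> (\<Sum>A\<in>Pow J. \<bar>weight J A x * (h A - h' A)\<bar>)" by (rule sum_abs)
  also have "\<dots> \<le> (\<Sum>A\<in>Pow J. weight J A x * \<epsilon>)"
  proof (rule sum_mono)
    fix A assume "A \<in> Pow J"
    then show "\<bar>weight J A x * (h A - h' A)\<bar> \<le> weight J A x * \<epsilon>"
      using assms(2)[of A] weight_nonneg[of J A x]
      by (cases "weight J A x = 0") (auto simp: abs_mult intro: mult_left_mono)
  qed
  also have "\<dots> = \<epsilon>" using weight_sum[OF assms(1)] by (simp flip: sum_distrib_right)
  finally show ?thesis .
qed

text \<open>Digits are independent: the digits in \<open>D\<close> integrate out.\<close>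

lemma weight_marginal:
  assumes "finite D" "finite J" "D \<inter> J = {}"
  shows "(\<Sum>A\<in>Pow (J \<union> D). weight (J \<union> D) A x * h (A \<inter> J)) = (\<Sum>A\<in>Pow J. weight J A x * h A)"
  using assms(1,3)
proof (induction D)
  case empty
  show ?case by (auto intro!: sum.cong simp: Int_absorb2)
next
  case (insert i D)
  let ?K = "J \<union> D"
  have i: "i \<notin> ?K" "finite ?K" using insert assms(2) by auto
  have w0: "weight (insert i ?K) A x = weight ?K A x * (1 - digit_prob i x)" if "A \<subseteq> ?K" for A
  proof -
    have "insert i ?K - A = insert i (?K - A)" "i \<notin> ?K - A" using i that by auto
    then show ?thesis using i(2) by (simp add: weight_def)
  qed
  have w1: "weight (insert i ?K) (insert i A) x = weight ?K A x * digit_prob i x" if "A \<subseteq> ?K" for A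
  proof -
    have "insert i ?K - insert i A = ?K - A" "i \<notin> A" using i that by auto
    then show ?thesis using i(2) finite_subset[OF that] by (simp add: weight_def)
  qed
  have inj: "inj_on (insert i) (Pow ?K)" using i(1) by (auto simp: inj_on_def)
  have int: "insert i A \<inter> J = A \<inter> J" for A using insert.prems by auto
  have "(\<Sum>A\<in>Pow (insert i ?K). weight (insert i ?K) A x * h (A \<inter> J)) =
      (\<Sum>A\<in>Pow ?K. weight (insert i ?K) A x * h (A \<inter> J)) +
      (\<Sum>A\<in>insert i ` Pow ?K. weight (insert i ?K) A x * h (A \<inter> J))"
    unfolding Pow_insert using i by (intro sum.union_disjoint) auto
  also have "(\<Sum>A\<in>insert i ` Pow ?K. weight (insert i ?K) A x * h (A \<inter> J)) =
      (\<Sum>A\<in>Pow ?K. weight ?K A x * digit_prob i x * h (A \<inter> J))"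
    by (subst sum.reindex[OF inj]) (auto intro!: sum.cong simp: w1 int)
  also have "(\<Sum>A\<in>Pow ?K. weight (insert i ?K) A x * h (A \<inter> J)) =
      (\<Sum>A\<in>Pow ?K. weight ?K A x * (1 - digit_prob i x) * h (A \<inter> J))"
    by (auto intro!: sum.cong simp: w0)
  also have "\<dots> + (\<Sum>A\<in>Pow ?K. weight ?K A x * digit_prob i x * h (A \<inter> J)) =
      (\<Sum>A\<in>Pow ?K. weight ?K A x * h (A \<inter> J))"
    by (subst sum.distrib[symmetric]) (auto intro!: sum.cong simp: algebra_simps)
  also have "\<dots> = (\<Sum>A\<in>Pow J. weight J A x * h A)" using insert by simp
  finally show ?case by simp
qed

lemma continuous_weight: "continuous_on UNIV (weight J A)"
  unfolding weight_def[abs_def] digit_prob_def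
  by (intro continuous_intros continuous_on_prod continuous_on_apply_bcontfun)

definition weight_fun :: "'i set \<Rightarrow> 'i set \<Rightarrow> 'a \<Rightarrow>\<^sub>C real"
  where "weight_fun J A = Bcontfun (weight J A)"

lemma weight_fun_apply [simp]: "apply_bcontfun (weight_fun J A) x = weight J A x"
proof -
  have "weight J A \<in> bcontfun"
    using continuous_weight weight_nonneg weight_le_1 by (intro bcontfun_normI[where b=1]) auto
  then show ?thesis by (simp add: weight_fun_def Bcontfun_inverse)
qed

definition finite_average :: "'i set \<Rightarrow> ('a \<Rightarrow>\<^sub>C real) \<Rightarrow>\<^sub>L ('a \<Rightarrow>\<^sub>C real)"
  where "finite_average J =
    (\<Sum>A\<in>Pow J. blinfun_scaleR_left (weight_fun J A) o\<^sub>L point_evaluation (pt A))"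

lemma finite_average_eq:
  "finite_average J \<phi> = (\<Sum>A\<in>Pow J. apply_bcontfun \<phi> (pt A) *\<^sub>R weight_fun J A)"
  by (simp add: finite_average_def blinfun.sum_left)

lemma finite_average_apply:
  "apply_bcontfun (finite_average J \<phi>) x = (\<Sum>A\<in>Pow J. weight J A x * apply_bcontfun \<phi> (pt A))"
  by (simp add: finite_average_eq apply_bcontfun_sum mult.commute)

lemma norm_finite_average_le: "norm (finite_average J) \<le> 1"
proof (cases "finite J")
  case True
  show ?thesis
  proof (rule norm_blinfun_bound)
    fix \<phi> show "norm (finite_average J \<phi>) \<le> 1 * norm \<phi>"
    proof (rule norm_bound)
      show "norm (apply_bcontfun (finite_average J \<phi>) x) \<le> 1 * norm \<phi>" for x
        using weight_average_close[OF True, of x "\<lambda>A. apply_bcontfun \<phi> (pt A)" "\<lambda>_. 0" "norm \<phi>"]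
        by (simp add: finite_average_apply apply_bcontfun_le_norm)
    qed
  qed simp
qed (simp add: finite_average_def)

text \<open>If the digits in \<open>H\<close> determine \<open>\<phi> (pt A)\<close> up to \<open>\<epsilon>\<close>, then randomising further digits outside
  \<open>H\<close> changes the average by at most \<open>\<epsilon>\<close>. This is the Cauchy property of the averages over finite
  subsets of any fixed index set.\<close>

lemma finite_average_stable:
  assumes H: "\<And>A B. A \<inter> H = B \<inter> H \<Longrightarrow> \<bar>apply_bcontfun \<phi> (pt A) - apply_bcontfun \<phi> (pt B)\<bar> \<le> \<epsilon>"
    and J: "finite J'" "J \<subseteq> J'" "J' \<inter> H \<subseteq> J"
  shows "dist (finite_average J' \<phi>) (finite_average J \<phi>) \<le> \<epsilon>"
proof (rule dist_bound)
  fix x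
  let ?h = "\<lambda>A. apply_bcontfun \<phi> (pt A)"
  have "(\<Sum>A\<in>Pow J'. weight J' A x * ?h (A \<inter> J)) = (\<Sum>A\<in>Pow J. weight J A x * ?h A)"
    using weight_marginal[of "J' - J" J x ?h] J finite_subset[of J J']
    by (simp add: Un_absorb1 Diff_disjoint Int_commute)
  moreover have "\<bar>(\<Sum>A\<in>Pow J'. weight J' A x * ?h A) - (\<Sum>A\<in>Pow J'. weight J' A x * ?h (A \<inter> J))\<bar> \<le> \<epsilon>"
    by (rule weight_average_close[OF J(1)], rule H) (use J in auto)
  ultimately show "dist (apply_bcontfun (finite_average J' \<phi>) x) (apply_bcontfun (finite_average J \<phi>) x) \<le> \<epsilon>"
    by (simp add: finite_average_apply dist_real_def)
qed

definition average :: "'i set \<Rightarrow> ('a \<Rightarrow>\<^sub>C real) \<Rightarrow>\<^sub>L ('a \<Rightarrow>\<^sub>C real)"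
  where "average S = (SOME L. norm L \<le> 1 \<and>
    (\<forall>\<phi>. ((\<lambda>J. finite_average J \<phi>) \<longlongrightarrow> blinfun_apply L \<phi>) (finite_subsets_at_top S)))"

lemma norm_average_le: "norm (average S) \<le> 1"
  and average_limit: "((\<lambda>J. finite_average J \<phi>) \<longlongrightarrow> average S \<phi>) (finite_subsets_at_top S)"
proof -
  obtain L where "norm L \<le> 1"
    "\<And>\<phi>. ((\<lambda>J. finite_average J \<phi>) \<longlongrightarrow> blinfun_apply L \<phi>) (finite_subsets_at_top S)"
  proof (rule pointwise_limit_of_contractions[of "finite_subsets_at_top S" finite_average])
    fix \<phi> and \<epsilon> :: real assume "\<epsilon> > 0"
    then obtain H where H: "finite H"
      "\<And>A B. A \<inter> H = B \<inter> H \<Longrightarrow> \<bar>apply_bcontfun \<phi> (pt A) - apply_bcontfun \<phi> (pt B)\<bar> < \<epsilon>/2"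
      using pt_continuous[of "\<epsilon>/2" \<phi>] by auto
    have "dist (finite_average J \<phi>) (finite_average (H \<inter> S) \<phi>) < \<epsilon>"
      if "finite J" "H \<inter> S \<subseteq> J" "J \<subseteq> S" for J
    proof -
      have "dist (finite_average J \<phi>) (finite_average (H \<inter> S) \<phi>) \<le> \<epsilon>/2"
        by (rule finite_average_stable[of H]) (use that less_imp_le[OF H(2)] in auto)
      then show ?thesis using \<open>\<epsilon> > 0\<close> by simp
    qed
    then show "\<exists>y. \<forall>\<^sub>F J in finite_subsets_at_top S. dist (finite_average J \<phi>) y < \<epsilon>"
      unfolding eventually_finite_subsets_at_top
      by (intro exI[of _ "finite_average (H \<inter> S) \<phi>"] exI[of _ "H \<inter> S"]) (use H(1) in auto)
  qed (simp_all add: norm_finite_average_le)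
  then have "\<exists>L. norm L \<le> 1 \<and>
      (\<forall>\<phi>. ((\<lambda>J. finite_average J \<phi>) \<longlongrightarrow> blinfun_apply L \<phi>) (finite_subsets_at_top S))" by blast
  from someI_ex[OF this] show "norm (average S) \<le> 1"
    "((\<lambda>J. finite_average J \<phi>) \<longlongrightarrow> average S \<phi>) (finite_subsets_at_top S)"
    unfolding average_def by blast+
qed

text \<open>For compact \<open>K\<close>, this is the closed subalgebra generated by the \<open>g i\<close> with \<open>i \<in> S\<close> and the constants.\<close>

definition determined_by :: "'i set \<Rightarrow> ('a \<Rightarrow>\<^sub>C real) set"
  where "determined_by S = {\<phi>. \<forall>x y. (\<forall>i\<in>S. apply_bcontfun (g i) x = apply_bcontfun (g i) y) \<longrightarrow>
    apply_bcontfun \<phi> x = apply_bcontfun \<phi> y}"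

lemma determined_by_mono: "S \<subseteq> T \<Longrightarrow> determined_by S \<subseteq> determined_by T"
  unfolding determined_by_def by blast

lemma const_determined_by: "const_bcontfun c \<in> determined_by S"
  by (simp add: determined_by_def)

lemma closed_determined_by: "closed (determined_by S)"
proof -
  have "determined_by S = (\<Inter>x. \<Inter>y\<in>{y. \<forall>i\<in>S. apply_bcontfun (g i) x = apply_bcontfun (g i) y}.
      {\<phi>. point_evaluation x \<phi> = point_evaluation y \<phi>})"
    by (auto simp: determined_by_def)
  moreover have "closed \<dots>"
    by (intro closed_INT ballI closed_Collect_eq) (auto intro!: continuous_intros simp del: point_evaluation_apply)
  ultimately show ?thesis by simp
qed

lemma weight_cong:
  assumes "\<And>i. i \<in> J \<Longrightarrow> apply_bcontfun (g i) x = apply_bcontfun (g i) y" and "A \<subseteq> J"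
  shows "weight J A x = weight J A y"
proof -
  have "digit_prob i x = digit_prob i y" if "i \<in> J" for i
    using assms(1)[OF that] by (simp add: digit_prob_def)
  then show ?thesis
    unfolding weight_def using assms(2) by (intro arg_cong2[of _ _ _ _ "(*)"] prod.cong) auto
qed

lemma finite_average_determined_by: "J \<subseteq> S \<Longrightarrow> finite_average J \<phi> \<in> determined_by S"
  unfolding determined_by_def mem_Collect_eq finite_average_apply
  by (intro allI impI sum.cong refl arg_cong2[of _ _ _ _ "(*)"] weight_cong) auto

lemma average_determined_by: "average S \<phi> \<in> determined_by S"
proof (rule Lim_in_closed_set[OF closed_determined_by _ _ average_limit])
  show "\<forall>\<^sub>F J in finite_subsets_at_top S. finite_average J \<phi> \<in> determined_by S"
    by (rule eventually_finite_subsets_at_top_weakI) (rule finite_average_determined_by)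
qed simp

text \<open>The decoding map descends to the quotient of \<open>K\<close> on which the \<open>g i\<close> with \<open>i \<in> S\<close> separate
  points: the image of \<open>pt A\<close> there is a function of the digits of \<open>A\<close> in \<open>S\<close>.\<close>

definition self_determined :: "'i set \<Rightarrow> bool"
  where "self_determined S \<longleftrightarrow>
    (\<forall>i\<in>S. \<forall>A. apply_bcontfun (g i) (pt A) = apply_bcontfun (g i) (pt (A \<inter> S)))"

text \<open>Digits in \<open>J\<close> that occur for \<open>x\<close> with positive probability can be completed to an admissible
  expansion \<open>B\<close> of \<open>x\<close>, so \<open>\<phi> (pt B) = \<phi> x\<close>. Deleting from \<open>B\<close> the digits outside \<open>S\<close> keeps the
  value of \<open>\<phi>\<close>, and what remains agrees with the digits in \<open>J\<close> on the finite set that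
  matters for \<open>\<phi>\<close>.\<close>

lemma finite_average_close:
  assumes S: "self_determined S" "\<phi> \<in> determined_by S" and \<epsilon>: "\<epsilon> > 0"
  obtains H where "finite H" "H \<subseteq> S"
    "\<And>J. finite J \<Longrightarrow> H \<subseteq> J \<Longrightarrow> J \<subseteq> S \<Longrightarrow> dist (finite_average J \<phi>) \<phi> < \<epsilon>"
proof -
  obtain H where H: "finite H"
    "\<And>A B. A \<inter> H = B \<inter> H \<Longrightarrow> \<bar>apply_bcontfun \<phi> (pt A) - apply_bcontfun \<phi> (pt B)\<bar> < \<epsilon>/2"
    using pt_continuous[of "\<epsilon>/2" \<phi>] \<epsilon> by auto
  have \<phi>S: "apply_bcontfun \<phi> (pt A) = apply_bcontfun \<phi> (pt (A \<inter> S))" for A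
    using S unfolding self_determined_def determined_by_def by blast
  have "dist (finite_average J \<phi>) \<phi> < \<epsilon>" if J: "finite J" "H \<inter> S \<subseteq> J" "J \<subseteq> S" for J
  proof -
    have "dist (finite_average J \<phi>) \<phi> \<le> \<epsilon>/2"
    proof (rule dist_bound)
      fix x
      have "\<bar>apply_bcontfun \<phi> (pt A) - apply_bcontfun \<phi> x\<bar> \<le> \<epsilon>/2"
        if A: "A \<subseteq> J" "weight J A x \<noteq> 0" for A
      proof -
        \<comment> \<open>outside \<open>J\<close> the digit \<open>1\<close> is taken whenever \<open>g i x \<ge> 1\<close>; otherwise the digit \<open>0\<close> is admissible\<close>
        define B where "B = A \<union> {i. i \<notin> J \<and> 1 \<le> apply_bcontfun (g i) x}"
        have fin: "finite A" "finite (J - A)" using A(1) J(1) finite_subset by auto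
        have "digit_prob i x \<noteq> 0" if "i \<in> A" for i
          using A(2) that fin unfolding weight_def by auto
        then have pos: "0 \<le> apply_bcontfun (g i) x" if "i \<in> A" for i
          using that by (force simp: digit_prob_def)
        have "digit_prob i x \<noteq> 1" if "i \<in> J - A" for i
          using A(2) that fin unfolding weight_def by auto
        then have small: "apply_bcontfun (g i) x \<le> 1" if "i \<in> J - A" for i
          using that by (force simp: digit_prob_def)
        have "pt B = x"
        proof (rule pt_expansion)
          show "0 \<le> apply_bcontfun (g i) x" if "i \<in> B" for i
            using that pos by (auto simp: B_def)
          show "apply_bcontfun (g i) x \<le> 1" if "i \<notin> B" for i
            using that small[of i] by (auto simp: B_def)
        qed
        then have "apply_bcontfun \<phi> (pt (B \<inter> S)) = apply_bcontfun \<phi> x" using \<phi>S by metis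
        moreover have "A \<inter> H = (B \<inter> S) \<inter> H" using A(1) J by (auto simp: B_def)
        ultimately show ?thesis using less_imp_le[OF H(2)] by metis
      qed
      then have "\<bar>(\<Sum>A\<in>Pow J. weight J A x * apply_bcontfun \<phi> (pt A)) -
          (\<Sum>A\<in>Pow J. weight J A x * apply_bcontfun \<phi> x)\<bar> \<le> \<epsilon>/2"
        by (intro weight_average_close J(1))
      then show "dist (apply_bcontfun (finite_average J \<phi>) x) (apply_bcontfun \<phi> x) \<le> \<epsilon>/2"
        using weight_sum[OF J(1), of x]
        by (simp add: finite_average_apply dist_real_def flip: sum_distrib_right)
    qed
    then show ?thesis using \<epsilon> by simp
  qed
  then show thesis using that[of "H \<inter> S"] H(1) by auto
qed

lemma average_eq:
  assumes "self_determined S" "\<phi> \<in> determined_by S"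
  shows "average S \<phi> = \<phi>"
proof -
  have "((\<lambda>J. finite_average J \<phi>) \<longlongrightarrow> \<phi>) (finite_subsets_at_top S)"
  proof (rule tendstoI)
    fix \<epsilon> :: real assume "\<epsilon> > 0"
    then obtain H where "finite H" "H \<subseteq> S"
      "\<And>J. finite J \<Longrightarrow> H \<subseteq> J \<Longrightarrow> J \<subseteq> S \<Longrightarrow> dist (finite_average J \<phi>) \<phi> < \<epsilon>"
      by (rule finite_average_close[OF assms]) auto
    then show "\<forall>\<^sub>F J in finite_subsets_at_top S. dist (finite_average J \<phi>) \<phi> < \<epsilon>"
      unfolding eventually_finite_subsets_at_top by blast
  qed
  then show ?thesis using average_limit tendsto_unique finite_subsets_at_top_neq_bot by blast
qed

text \<open>The approximations to \<open>\<phi>\<close> by finite averages involve only finitely many of the functions \<open>g i\<close>.\<close>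

lemma determined_by_directed_union:
  assumes "self_determined S"
    and "\<And>J. finite J \<Longrightarrow> J \<subseteq> S \<Longrightarrow> \<exists>T\<in>\<T>. J \<subseteq> T"
  shows "determined_by S \<subseteq> closure (\<Union>T\<in>\<T>. determined_by T)"
proof
  fix \<phi> assume \<phi>: "\<phi> \<in> determined_by S"
  show "\<phi> \<in> closure (\<Union>T\<in>\<T>. determined_by T)"
    unfolding closure_approachable
  proof (intro allI impI)
    fix \<epsilon> :: real assume "\<epsilon> > 0"
    then obtain H where H: "finite H" "H \<subseteq> S" "dist (finite_average H \<phi>) \<phi> < \<epsilon>"
      by (rule finite_average_close[OF assms(1) \<phi>]) auto
    then obtain T where "T \<in> \<T>" "H \<subseteq> T" using assms(2) by blast
    then have "finite_average H \<phi> \<in> (\<Union>T\<in>\<T>. determined_by T)"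
      using finite_average_determined_by by blast
    then show "\<exists>y\<in>\<Union>T\<in>\<T>. determined_by T. dist y \<phi> < \<epsilon>" using H(3) by blast
  qed
qed

text \<open>A finite average is a linear combination of the weight functions of a finite set of digits,
  and there are countably many such functions for the finite subsets of a countable \<open>S\<close>.\<close>

lemma countable_dense_determined_by:
  assumes "self_determined S" "countable S"
  obtains D where "countable D" "determined_by S \<subseteq> closure D"
proof -
  let ?W = "\<Union>J\<in>{J. J \<subseteq> S \<and> finite J}. weight_fun J ` Pow J"
  have "countable ?W"
    using countable_Collect_finite_subset[OF assms(2)]
    by (intro countable_UN countable_image)
      (auto simp: conj_commute intro: countable_finite)
  then obtain D where D: "countable D" "span ?W \<subseteq> closure D" by (rule countable_dense_in_span)
  have "determined_by S \<subseteq> closure (span ?W)"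
  proof
    fix \<phi> assume \<phi>: "\<phi> \<in> determined_by S"
    show "\<phi> \<in> closure (span ?W)"
      unfolding closure_approachable
    proof (intro allI impI)
      fix \<epsilon> :: real assume "\<epsilon> > 0"
      then obtain H where H: "finite H" "H \<subseteq> S" "dist (finite_average H \<phi>) \<phi> < \<epsilon>"
        by (rule finite_average_close[OF assms(1) \<phi>]) auto
      have "finite_average H \<phi> \<in> span ?W"
        unfolding finite_average_eq using H by (intro span_sum span_scale span_base) blast
      then show "\<exists>y\<in>span ?W. dist y \<phi> < \<epsilon>" using H(3) by blast
    qed
  qed
  also have "\<dots> \<subseteq> closure D" using D(2) closed_closure by (rule closure_minimal)
  finally show thesis using D(1) that by blast
qed

text \<open>Collect the finitely many digits that determine \<open>\<phi> (pt A)\<close> up to \<open>1/(n+1)\<close>, for all \<open>n\<close>.\<close>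

lemma exists_countable_dependency:
  fixes \<phi> :: "'a \<Rightarrow>\<^sub>C real"
  obtains c where "countable c" "\<And>A. apply_bcontfun \<phi> (pt A) = apply_bcontfun \<phi> (pt (A \<inter> c))"
proof -
  have "\<exists>H. finite H \<and> (\<forall>A B. A \<inter> H = B \<inter> H \<longrightarrow>
      \<bar>apply_bcontfun \<phi> (pt A) - apply_bcontfun \<phi> (pt B)\<bar> < inverse (real (Suc n)))" for n
    by (rule pt_continuous) simp
  then obtain H where H: "\<And>n. finite (H n)" "\<And>n A B. A \<inter> H n = B \<inter> H n \<Longrightarrow>
      \<bar>apply_bcontfun \<phi> (pt A) - apply_bcontfun \<phi> (pt B)\<bar> < inverse (real (Suc n))" by metis
  show thesis
  proof
    show "countable (\<Union>n. H n)" using H(1) by (auto intro: countable_finite)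
    fix A
    have *: "\<bar>apply_bcontfun \<phi> (pt A) - apply_bcontfun \<phi> (pt (A \<inter> (\<Union>n. H n)))\<bar> < inverse (real (Suc n))" for n
      by (rule H(2)) auto
    show "apply_bcontfun \<phi> (pt A) = apply_bcontfun \<phi> (pt (A \<inter> (\<Union>n. H n)))"
      using * reals_Archimedean
      by (metis eq_iff_diff_eq_0 less_asym zero_less_abs_iff)
  qed
qed

lemma self_determinedI:
  assumes c: "\<And>i A. apply_bcontfun (g i) (pt A) = apply_bcontfun (g i) (pt (A \<inter> c i))"
    and S: "\<And>i. i \<in> S \<Longrightarrow> c i \<subseteq> S"
  shows "self_determined S"
  unfolding self_determined_def
proof (intro ballI allI)
  fix i A assume "i \<in> S"
  then have "A \<inter> c i = A \<inter> S \<inter> c i" using S by blast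
  then show "apply_bcontfun (g i) (pt A) = apply_bcontfun (g i) (pt (A \<inter> S))" using c by metis
qed

lemma self_determined_UNIV: "self_determined UNIV"
  by (simp add: self_determined_def)

lemma determined_by_UNIV: "determined_by UNIV = UNIV"
proof -
  have "x = y" if eq: "\<forall>i. apply_bcontfun (g i) x = apply_bcontfun (g i) y" for x y
  proof -
    let ?A = "{i. 1 \<le> apply_bcontfun (g i) x}"
    have "pt ?A = x" by (rule pt_expansion) auto
    moreover have "pt ?A = y" by (rule pt_expansion) (auto simp: eq)
    ultimately show ?thesis by simp
  qed
  then have "\<phi> \<in> determined_by UNIV" for \<phi>
    unfolding determined_by_def by (intro CollectI allI impI) (rule arg_cong, simp)
  then show ?thesis by blast
qed

lemma exists_countable_determining_set:
  obtains S where "countable S" "\<phi> \<in> determined_by S"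
proof -
  have "\<exists>J. finite J \<and> dist (finite_average J \<phi>) \<phi> < inverse (real (Suc n))" for n
  proof -
    obtain H where "finite H"
      "\<And>J. finite J \<Longrightarrow> H \<subseteq> J \<Longrightarrow> J \<subseteq> UNIV \<Longrightarrow> dist (finite_average J \<phi>) \<phi> < inverse (real (Suc n))"
      by (rule finite_average_close[OF self_determined_UNIV, of \<phi> "inverse (real (Suc n))"])
        (auto simp: determined_by_UNIV)
    then show ?thesis by blast
  qed
  then obtain J where J: "\<And>n. finite (J n)" "\<And>n. dist (finite_average (J n) \<phi>) \<phi> < inverse (real (Suc n))"
    by metis
  show thesis
  proof
    show "countable (\<Union>n. J n)" using J(1) by (auto intro: countable_finite)
    have lim: "(\<lambda>n. finite_average (J n) \<phi>) \<longlonglongrightarrow> \<phi>"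
    proof (subst tendsto_dist_iff, rule tendsto_sandwich[OF _ _ tendsto_const LIMSEQ_inverse_real_of_nat])
      show "\<forall>\<^sub>F n in sequentially. dist (finite_average (J n) \<phi>) \<phi> \<le> inverse (real (Suc n))"
        by (rule always_eventually) (use J(2) less_imp_le in blast)
    qed simp
    have "finite_average (J n) \<phi> \<in> determined_by (\<Union>n. J n)" for n
      by (rule finite_average_determined_by) auto
    then show "\<phi> \<in> determined_by (\<Union>n. J n)"
      by (rule closed_sequentially[OF closed_determined_by _ lim])
  qed
qed

end

section \<open>Digit maps on Dugundji compact spaces\<close>

text \<open>The relation between points and their admissible expansions. When \<open>K\<close> is compact, the part of it
  over a closed subset of \<open>K\<close> projects to a closed subset of the cube.\<close>

lemma closedin_digit_graph:
  fixes g :: "'i \<Rightarrow> 'a::t2_space \<Rightarrow>\<^sub>C real"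
  shows "closedin (prod_topology (product_topology (\<lambda>_. discrete_topology (UNIV :: bool set)) (UNIV :: 'i set)) euclidean)
    {(a, x). \<forall>i. (a i \<longrightarrow> 0 \<le> apply_bcontfun (g i) x) \<and> (\<not> a i \<longrightarrow> apply_bcontfun (g i) x \<le> 1)}"
    (is "closedin (prod_topology ?X euclidean) ?G")
proof -
  have dig: "closedin ?X {a. a i \<in> B}" for i B
  proof -
    have "continuous_map ?X (discrete_topology UNIV) (\<lambda>a. a i)"
      by (rule continuous_map_product_projection) simp
    from closedin_continuous_map_preimage[OF this, of B] show ?thesis by simp
  qed
  have le: "closed {x. 0 \<le> apply_bcontfun (g i) x}" "closed {x. apply_bcontfun (g i) x \<le> 1}" for i
    by (intro closed_Collect_le continuous_on_const continuous_on_apply_bcontfun)+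
  let ?Gi = "\<lambda>i. {a. a i \<in> {True}} \<times> {x. 0 \<le> apply_bcontfun (g i) x} \<union>
      {a. a i \<in> {False}} \<times> {x. apply_bcontfun (g i) x \<le> 1}"
  have "closedin (prod_topology ?X euclidean) (?Gi i)" for i
    by (intro closedin_Un) (simp_all only: closedin_prod_Times_iff dig le closed_closedin[symmetric] simp_thms)
  then have "closedin (prod_topology ?X euclidean) (\<Inter>i. ?Gi i)" by (intro closedin_INT) auto
  moreover have "(\<Inter>i. ?Gi i) = ?G" by auto
  ultimately show ?thesis by simp
qed

text \<open>A digit sequence is an admissible expansion of at most one point, because \<open>x \<noteq> y\<close> are separated by
  a \<open>g i\<close> for which \<open>x\<close> forces the digit \<open>0\<close> and \<open>y\<close> the digit \<open>1\<close>. This decoding is continuous on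
  the closed set of admissible expansions by compactness of the relation, and the Dugundji
  property extends it to the cube. Uniform continuity on the cube gives the finite sets of digits.\<close>

theorem dugundji_digit_map:
  fixes g :: "'i \<Rightarrow> 'a::t2_space \<Rightarrow>\<^sub>C real"
  assumes K: "dugundji_compact (euclidean :: 'a topology)"
    and sep: "\<And>x y. x \<noteq> y \<Longrightarrow> \<exists>i. apply_bcontfun (g i) x < 0 \<and> 1 < apply_bcontfun (g i) y"
  obtains pt where "digit_map g pt"
proof -
  define X where "X = product_topology (\<lambda>_. discrete_topology (UNIV :: bool set)) (UNIV :: 'i set)"
  define G where "G = {(a, x). \<forall>i. (a i \<longrightarrow> 0 \<le> apply_bcontfun (g i) x) \<and> (\<not> a i \<longrightarrow> apply_bcontfun (g i) x \<le> 1)}"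
  have topX: "topspace X = UNIV" by (simp add: X_def)
  have X: "compact_space X" "Hausdorff_space X" "X dim_le 0"
    unfolding X_def
    by (simp_all add: compact_space_product_topology Hausdorff_space_product_topology
        dim_le_0_discrete_power compact_space_discrete_topology)
  have G: "closedin (prod_topology X euclidean) G"
    unfolding X_def G_def by (rule closedin_digit_graph)
  have compact_K: "compact_space (euclidean :: 'a topology)" using K by (simp add: dugundji_compact_def)
  then have compact_prod: "compact_space (prod_topology X (euclidean :: 'a topology))"
    using X(1) by (simp add: compact_space_prod_topology)
  have proj: "closedin X (fst ` (G \<inter> UNIV \<times> T))" if "closed T" for T
  proof -
    have "closedin (prod_topology X euclidean) (UNIV \<times> T)"
      using that topX by (simp add: closedin_prod_Times_iff) (metis closedin_topspace topX)
    then have "compactin (prod_topology X euclidean) (G \<inter> UNIV \<times> T)"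
      using G compact_prod by (intro closedin_compact_space closedin_Int)
    then have "compactin X (fst ` (G \<inter> UNIV \<times> T))"
      using image_compactin continuous_map_fst by blast
    then show ?thesis using X(2) by (intro compactin_imp_closedin)
  qed
  define A where "A = fst ` G"
  have A: "closedin X A" using proj[of UNIV] by (simp add: A_def)
  have unique: "x = y" if "(a, x) \<in> G" "(a, y) \<in> G" for a x y
  proof (rule ccontr)
    assume "x \<noteq> y"
    then obtain i where i: "apply_bcontfun (g i) x < 0" "1 < apply_bcontfun (g i) y" using sep by blast
    show False
    proof (cases "a i")
      case True
      then have "0 \<le> apply_bcontfun (g i) x" using that by (simp add: G_def)
      then show False using i by simp
    next
      case False
      then have "apply_bcontfun (g i) y \<le> 1" using that by (simp add: G_def)
      then show False using i by simp
    qed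
  qed
  define f where "f a = (SOME x. (a, x) \<in> G)" for a
  have f: "f a = x" if "(a, x) \<in> G" for a x
    unfolding f_def using that unique by (intro some_equality)
  have "continuous_map (subtopology X A) euclidean f"
    unfolding continuous_map_closedin
  proof (intro conjI ballI allI impI)
    fix T :: "'a set" assume "closedin euclidean T"
    then have T: "closed T" by simp
    have "{a \<in> A. f a \<in> T} = fst ` (G \<inter> UNIV \<times> T)"
      using f by (force simp: A_def)
    then have "{a \<in> topspace (subtopology X A). f a \<in> T} = fst ` (G \<inter> UNIV \<times> T)"
      using topX by simp
    moreover have "fst ` (G \<inter> UNIV \<times> T) \<subseteq> A" by (auto simp: A_def)
    ultimately show "closedin (subtopology X A) {a \<in> topspace (subtopology X A). f a \<in> T}"
      using proj[OF T] closedin_subset_topspace by metis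
  qed simp
  from dugundji_compact_extends[OF K X A this]
  obtain F where F: "continuous_map X euclidean F" "\<And>a. a \<in> A \<Longrightarrow> F a = f a" by blast
  define pt where "pt S = F (\<lambda>i. i \<in> S)" for S
  have "digit_map g pt"
  proof
    fix S x
    assume "\<And>i. i \<in> S \<Longrightarrow> 0 \<le> apply_bcontfun (g i) x" "\<And>i. i \<notin> S \<Longrightarrow> apply_bcontfun (g i) x \<le> 1"
    then have "((\<lambda>i. i \<in> S), x) \<in> G" by (simp add: G_def)
    then show "pt S = x" using F(2) f unfolding pt_def A_def by (metis fst_conv image_eqI)
  next
    fix \<phi> :: "'a \<Rightarrow>\<^sub>C real" and \<epsilon> :: real assume "\<epsilon> > 0"
    define \<psi> where "\<psi> a = apply_bcontfun \<phi> (F a)" for a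
    have "continuous_map euclidean euclidean (apply_bcontfun \<phi>)" by simp
    from continuous_map_compose[OF F(1) this]
    have \<psi>: "continuous_map X euclidean \<psi>" by (simp add: \<psi>_def[abs_def] comp_def)
    \<comment> \<open>basic open boxes, restricted in finitely many digits, on which \<open>\<psi>\<close> varies by less than \<open>\<epsilon>/2\<close>\<close>
    have "\<exists>U. finite {i. U i \<noteq> UNIV} \<and> a \<in> Pi\<^sub>E UNIV U \<and> Pi\<^sub>E UNIV U \<subseteq> {b. \<bar>\<psi> b - \<psi> a\<bar> < \<epsilon>/2}" for a
    proof -
      have "openin X {b \<in> topspace X. \<psi> b \<in> ball (\<psi> a) (\<epsilon>/2)}"
        using \<psi> by (rule openin_continuous_map_preimage) simp
      then have "openin X {b. \<bar>\<psi> b - \<psi> a\<bar> < \<epsilon>/2}"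
        by (simp add: topX ball_def dist_real_def abs_minus_commute)
      moreover have "a \<in> {b. \<bar>\<psi> b - \<psi> a\<bar> < \<epsilon>/2}" using \<open>\<epsilon> > 0\<close> by simp
      ultimately obtain U where "finite {i \<in> UNIV. U i \<noteq> topspace (discrete_topology (UNIV :: bool set))}"
          "a \<in> Pi\<^sub>E UNIV U" "Pi\<^sub>E UNIV U \<subseteq> {b. \<bar>\<psi> b - \<psi> a\<bar> < \<epsilon>/2}"
        unfolding X_def openin_product_topology_alt by meson
      then show ?thesis by (intro exI[of _ U]) simp
    qed
    then obtain U where U: "\<And>a. finite {i. U a i \<noteq> UNIV}" "\<And>a. a \<in> Pi\<^sub>E UNIV (U a)"
      "\<And>a b. b \<in> Pi\<^sub>E UNIV (U a) \<Longrightarrow> \<bar>\<psi> b - \<psi> a\<bar> < \<epsilon>/2" by (metis mem_Collect_eq subsetD)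
    have op: "openin X (Pi\<^sub>E UNIV (U a))" for a
      unfolding X_def by (rule openin_PiE_gen[THEN iffD2]) (use U(1) in simp)
    have "compactin X UNIV" using X(1) topX by (simp add: compact_space_def)
    moreover have "\<forall>V \<in> range (\<lambda>a. Pi\<^sub>E UNIV (U a)). openin X V" using op by blast
    moreover have "UNIV \<subseteq> \<Union>(range (\<lambda>a. Pi\<^sub>E UNIV (U a)))" using U(2) by blast
    ultimately obtain \<F> where "finite \<F>" "\<F> \<subseteq> range (\<lambda>a. Pi\<^sub>E UNIV (U a))" "UNIV \<subseteq> \<Union>\<F>"
      unfolding compactin_def by metis
    then obtain N where N: "finite N" "(\<Union>a\<in>N. Pi\<^sub>E UNIV (U a)) = UNIV"
      by (metis finite_subset_image top.extremum_uniqueI)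
    define H where "H = (\<Union>a\<in>N. {i. U a i \<noteq> UNIV})"
    have "\<bar>\<psi> (\<lambda>i. i \<in> S) - \<psi> (\<lambda>i. i \<in> T)\<bar> < \<epsilon>" if ST: "S \<inter> H = T \<inter> H" for S T
    proof -
      obtain a where a: "a \<in> N" "(\<lambda>i. i \<in> S) \<in> Pi\<^sub>E UNIV (U a)" using N(2) by blast
      have "(i \<in> T) \<in> U a i" for i
      proof (cases "U a i = UNIV")
        case False
        then have "i \<in> H" using a(1) by (auto simp: H_def)
        then have "(i \<in> T) = (i \<in> S)" using ST by blast
        then show ?thesis using a(2) by auto
      qed simp
      then have "(\<lambda>i. i \<in> T) \<in> Pi\<^sub>E UNIV (U a)" by auto
      from U(3)[OF this] U(3)[OF a(2)] show ?thesis by linarith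
    qed
    moreover have "finite H" using N(1) U(1) by (auto simp: H_def)
    ultimately show "\<exists>H. finite H \<and> (\<forall>S T. S \<inter> H = T \<inter> H \<longrightarrow>
        \<bar>apply_bcontfun \<phi> (pt S) - apply_bcontfun \<phi> (pt T)\<bar> < \<epsilon>)"
      unfolding \<psi>_def pt_def by blast
  qed
  then show thesis by (rule that)
qed

lemma Hausdorff_space_t2: "Hausdorff_space (euclidean :: 'a::t2_space topology)"
  unfolding Hausdorff_space_def disjnt_def using hausdorff by fastforce

lemma closed_singleton_t2: "closed {x :: 'a::t2_space}"
  using Hausdorff_imp_t1_space[OF Hausdorff_space_t2] t1_space_closedin_singleton[of "euclidean :: 'a topology"]
  by simp

lemma compact_t2_separating_function:
  fixes y :: "'a::t2_space"
  assumes K: "compact_space (euclidean :: 'a topology)" and S: "closed S" "y \<notin> S"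
  obtains \<phi> :: "'a \<Rightarrow>\<^sub>C real" where "\<And>x. x \<in> S \<Longrightarrow> apply_bcontfun \<phi> x < 0" "1 < apply_bcontfun \<phi> y"
proof -
  have "closed {y}" by (rule closed_singleton_t2)
  have "normal_space (euclidean :: 'a topology)"
    using K Hausdorff_space_t2 compact_Hausdorff_or_regular_imp_normal_space by blast
  then obtain f where f: "continuous_map euclidean (top_of_set {-1..2::real}) f" "f ` S \<subseteq> {-1}" "f ` {y} \<subseteq> {2}"
    by (rule Urysohn_lemma[of _ S "{y}" "-1" 2]) (use S \<open>closed {y}\<close> in auto)
  have "continuous_on UNIV f" and range: "f z \<in> {-1..2}" for z
    using f(1) by (auto simp: continuous_map_in_subtopology image_subset_iff)
  moreover have "norm (f z) \<le> 2" for z using range[of z] by (simp add: abs_le_iff)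
  ultimately have "f \<in> bcontfun" by (intro bcontfun_normI)
  then have "apply_bcontfun (Bcontfun f) = f" by (rule Bcontfun_inverse)
  moreover have "f x = -1" if "x \<in> S" for x using f(2) that by blast
  moreover have "f y = 2" using f(3) by blast
  ultimately show thesis by (intro that[of "Bcontfun f"]) simp_all
qed

lemma card_of_omega_one: "card_of (UNIV :: omega_one set) =o aleph_one"
proof -
  have "bij_betw Rep_omega_one UNIV (Field aleph_one)"
    using type_definition.Rep_range[OF type_definition_omega_one] Rep_omega_one_inject
    by (intro bij_betw_imageI) (auto simp: inj_on_def)
  then have "|UNIV :: omega_one set| =o |Field aleph_one|" by (rule card_of_ordIsoI)
  also have "|Field aleph_one| =o aleph_one"
    by (rule card_of_Field_ordIso) (rule cardSuc_Card_order[OF natLeq_Card_order])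
  finally show ?thesis .
qed

text \<open>For each pair of members \<open>U\<close>, \<open>V\<close> of a base of size \<open>\<aleph>\<^sub>1\<close>, pick a function that is negative on
  \<open>U\<close> and larger than \<open>1\<close> on \<open>V\<close>, if there is one. Any function separating two points in this way
  does so on basic neighbourhoods, so the picked functions separate points as well.\<close>

lemma has_weight_separating_family:
  assumes K: "compact_space (euclidean :: 'a::t2_space topology)"
    and "has_weight (euclidean :: 'a topology) aleph_one"
  obtains g :: "omega_one \<Rightarrow> 'a::t2_space \<Rightarrow>\<^sub>C real"
  where "\<And>x y. x \<noteq> y \<Longrightarrow> \<exists>i. apply_bcontfun (g i) x < 0 \<and> 1 < apply_bcontfun (g i) y"
proof -
  obtain \<B> :: "'a set set" where
    \<B>: "openin (euclidean :: 'a topology) = arbitrary union_of (\<lambda>U. U \<in> \<B>)" "|\<B>| =o aleph_one"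
    using assms(2) unfolding has_weight_def by blast
  have "|UNIV :: omega_one set| =o |\<B>|"
    using card_of_omega_one \<B>(2) ordIso_symmetric ordIso_transitive by blast
  then obtain b where b: "bij_betw b (UNIV :: omega_one set) \<B>"
    using card_of_ordIso by blast
  have "infinite (UNIV :: omega_one set)"
    using uncountable_omega_one countable_finite by blast
  then have "|UNIV :: omega_one set| =o |(UNIV :: omega_one set) \<times> (UNIV :: omega_one set)|"
    by (rule ordIso_symmetric[OF card_of_Times_same_infinite])
  then obtain e where e: "bij_betw e (UNIV :: omega_one set) ((UNIV :: omega_one set) \<times> (UNIV :: omega_one set))"
    using card_of_ordIso by blast
  define sep where "sep U V \<phi> \<longleftrightarrow> (\<forall>x\<in>U. apply_bcontfun \<phi> x < 0) \<and> (\<forall>x\<in>V. 1 < apply_bcontfun \<phi> x)"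
    for U V and \<phi> :: "'a \<Rightarrow>\<^sub>C real"
  define g where "g i = (SOME \<phi>. sep (b (fst (e i))) (b (snd (e i))) \<phi>)" for i
  have basic: "\<exists>i. x \<in> b i \<and> b i \<subseteq> W" if W: "open W" "x \<in> W" for x W
  proof -
    have "(arbitrary union_of (\<lambda>U. U \<in> \<B>)) W" using \<B>(1) W(1) by (metis open_openin)
    then obtain U where "U \<in> \<B>" "x \<in> U" "U \<subseteq> W"
      using W(2) unfolding union_of_def by auto
    then show ?thesis using b unfolding bij_betw_def by (metis imageE)
  qed
  have "\<exists>i. apply_bcontfun (g i) x < 0 \<and> 1 < apply_bcontfun (g i) y" if xy: "x \<noteq> y" for x y
  proof -
    obtain \<phi> :: "'a \<Rightarrow>\<^sub>C real" where \<phi>: "apply_bcontfun \<phi> x < 0" "1 < apply_bcontfun \<phi> y"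
      by (rule compact_t2_separating_function[OF K closed_singleton_t2, of y x]) (use xy in auto)
    have "open {z. apply_bcontfun \<phi> z < 0}" "open {z. 1 < apply_bcontfun \<phi> z}"
      by (intro open_Collect_less continuous_on_const continuous_on_apply_bcontfun)+
    then obtain j k where jk: "x \<in> b j" "b j \<subseteq> {z. apply_bcontfun \<phi> z < 0}"
      "y \<in> b k" "b k \<subseteq> {z. 1 < apply_bcontfun \<phi> z}"
      using basic[of _ x] basic[of _ y] \<phi> by (metis mem_Collect_eq)
    obtain i where i: "e i = (j, k)" using e unfolding bij_betw_def by (metis UNIV_I UNIV_Times_UNIV imageE)
    have "sep (b j) (b k) \<phi>" using jk by (auto simp: sep_def)
    then have "sep (b j) (b k) (g i)" unfolding g_def i fst_conv snd_conv by (rule someI)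
    then show ?thesis using jk by (auto simp: sep_def)
  qed
  then show thesis by (rule that)
qed

section \<open>The resolution of the identity\<close>

lemma norm_const_bcontfun_1: "norm (const_bcontfun 1 :: 'a::topological_space \<Rightarrow>\<^sub>C real) = 1"
proof (rule antisym)
  show "norm (const_bcontfun 1 :: 'a \<Rightarrow>\<^sub>C real) \<le> 1" by (rule norm_bound) simp
  show "1 \<le> norm (const_bcontfun 1 :: 'a \<Rightarrow>\<^sub>C real)"
    using apply_bcontfun_le_norm[of "const_bcontfun 1 :: 'a \<Rightarrow>\<^sub>C real"] by simp
qed

text \<open>If \<open>f \<ge> 0\<close> and \<open>c = \<parallel>f\<parallel>\<close>, then \<open>\<parallel>c - f\<parallel> \<le> c\<close>, hence \<open>\<parallel>c - T f\<parallel> \<le> c\<close>, which forces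
  \<open>T f \<ge> 0\<close>.\<close>

lemma regular_operatorI:
  fixes T :: "('a::topological_space \<Rightarrow>\<^sub>C real) \<Rightarrow>\<^sub>L ('a \<Rightarrow>\<^sub>C real)"
  assumes T: "norm T \<le> 1" and one: "T (const_bcontfun 1) = const_bcontfun 1"
  shows "regular_operator T" and "norm T = 1"
proof -
  have "0 \<le> apply_bcontfun (T f) x" if f: "\<forall>x. 0 \<le> apply_bcontfun f x" for f x
  proof -
    let ?c = "norm f *\<^sub>R const_bcontfun 1 :: 'a \<Rightarrow>\<^sub>C real"
    have "norm (?c - f) \<le> norm f"
      by (rule norm_bound) (use f apply_bcontfun_le_norm[of f] in \<open>auto simp: abs_le_iff\<close>)
    then have "norm (T (?c - f)) \<le> norm f"
      using norm_blinfun[of T "?c - f"] mult_right_mono[OF T norm_ge_zero[of "?c - f"]] by simp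
    moreover have "T (?c - f) = ?c - T f"
      by (simp add: blinfun.diff_right blinfun.scaleR_right one)
    ultimately have "\<bar>apply_bcontfun (?c - T f) x\<bar> \<le> norm f"
      using apply_bcontfun_le_norm[of "?c - T f" x] by simp
    then show ?thesis by simp
  qed
  moreover have "linear T" using blinfun.bounded_linear_right bounded_linear.linear by blast
  ultimately show "regular_operator T" unfolding regular_operator_def using one by blast
  show "norm T = 1"
    using T norm_blinfun[of T "const_bcontfun 1"] by (simp add: one norm_const_bcontfun_1)
qed

lemma countable_rtrancl_Image:
  assumes "\<And>i. countable (r `` {i})" and "countable A"
  shows "countable (r\<^sup>* `` A)"
proof -
  have "countable ((r ^^ n) `` A)" for n
  proof (induction n)
    case (Suc n)
    have "(r ^^ Suc n) `` A = (\<Union>i\<in>(r ^^ n) `` A. r `` {i})" by auto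
    then show ?case using Suc assms(1) by simp
  qed (use assms(2) in simp)
  moreover have "r\<^sup>* `` A = (\<Union>n. (r ^^ n) `` A)" 
    by (auto simp: rtrancl_power Image_iff Bex_def; blast)
  ultimately show ?thesis by simp
qed

lemma separable_space_range:
  fixes T :: "'e::real_normed_vector \<Rightarrow>\<^sub>L 'f::real_normed_vector"
  assumes "countable D" and "range T \<subseteq> closure (T ` D)"
  shows "separable_space (top_of_set (range T))"
  unfolding separable_space_def
  using assms by (intro exI[of _ "T ` D"]) (auto simp: closure_of_subtopology Int_absorb1 image_mono)

text \<open>A dense set \<open>D\<close> of functions yields a base of \<open>K\<close> that is no larger: the sets where some
  \<open>\<phi> \<in> D\<close> exceeds \<open>1/2\<close>, since a function that is larger than \<open>1\<close> at a point and negative off a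
  neighbourhood can be approximated within \<open>1/2\<close> by a member of \<open>D\<close>.\<close>

lemma card_dense_ge:
  assumes K: "compact_space (euclidean :: 'a::t2_space topology)"
    and weight: "has_weight (euclidean :: 'a topology) aleph_one"
    and D: "closure D = (UNIV :: ('a::t2_space \<Rightarrow>\<^sub>C real) set)"
  shows "aleph_one \<le>o card_of D"
proof -
  define half where "half \<phi> = {x. 1/2 < apply_bcontfun \<phi> x}" for \<phi> :: "'a \<Rightarrow>\<^sub>C real"
  have open_half: "open (half \<phi>)" for \<phi>
    unfolding half_def by (intro open_Collect_less continuous_on_const continuous_on_apply_bcontfun)
  have inner: "\<exists>\<phi>\<in>D. x \<in> half \<phi> \<and> half \<phi> \<subseteq> W" if W: "open W" "x \<in> W" for x W
  proof -
    have "closed (- W)" "x \<notin> - W" using W by auto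
    then obtain \<psi> :: "'a \<Rightarrow>\<^sub>C real"
      where \<psi>: "\<And>y. y \<in> - W \<Longrightarrow> apply_bcontfun \<psi> y < 0" "1 < apply_bcontfun \<psi> x"
      by (rule compact_t2_separating_function[OF K]) (rule that)
    have "\<psi> \<in> closure D" using D by simp
    then obtain \<phi> where \<phi>: "\<phi> \<in> D" "dist \<phi> \<psi> < 1/2"
      unfolding closure_approachable by (meson half_gt_zero zero_less_one)
    have near: "\<bar>apply_bcontfun \<phi> y - apply_bcontfun \<psi> y\<bar> < 1/2" for y
      using \<phi>(2) dist_fun_lt_imp_dist_val_lt[of \<phi> \<psi> "1/2" y] by (simp add: dist_real_def)
    have "x \<in> half \<phi>" unfolding half_def mem_Collect_eq using near[of x] \<psi>(2) by linarith
    moreover have "y \<in> W" if "y \<in> half \<phi>" for y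
    proof (rule ccontr)
      assume "y \<notin> W"
      then have "apply_bcontfun \<psi> y < 0" using \<psi>(1) by simp
      moreover have "1/2 < apply_bcontfun \<phi> y" using that by (simp add: half_def)
      ultimately show False using near[of y] by linarith
    qed
    ultimately show ?thesis using \<phi>(1) by blast
  qed
  have "openin euclidean = arbitrary union_of (\<lambda>U. U \<in> half ` D)"
  proof (rule ext, rule iffI)
    fix W :: "'a set" assume "openin euclidean W"
    then have "open W" by simp
    have "W = \<Union>{U \<in> half ` D. U \<subseteq> W}" using inner[OF \<open>open W\<close>] by blast
    then show "(arbitrary union_of (\<lambda>U. U \<in> half ` D)) W"
      unfolding union_of_def arbitrary_def by (intro exI[of _ "{U \<in> half ` D. U \<subseteq> W}"]) auto
  next
    fix W :: "'a set" assume "(arbitrary union_of (\<lambda>U. U \<in> half ` D)) W"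
    then show "openin euclidean W" using open_half unfolding union_of_def by auto
  qed
  then have "aleph_one \<le>o card_of (half ` D)" using weight unfolding has_weight_def by blast
  then show ?thesis by (rule ordLeq_transitive[OF _ card_of_image])
qed

lemma has_density_of_separable_exhaustion:
  fixes C :: "omega_one \<Rightarrow> 'e::metric_space set"
  assumes lower: "\<And>D. closure D = (UNIV :: 'e set) \<Longrightarrow> aleph_one \<le>o card_of D"
    and sep: "\<And>\<alpha>. \<exists>D. countable D \<and> C \<alpha> \<subseteq> closure D"
    and exh: "(\<Union>\<alpha>. C \<alpha>) = UNIV"
  shows "has_density (euclidean :: 'e topology) aleph_one"
proof -
  obtain D where D: "\<And>\<alpha>. countable (D \<alpha>)" "\<And>\<alpha>. C \<alpha> \<subseteq> closure (D \<alpha>)" using sep by metis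
  let ?D = "\<Union>\<alpha>. D \<alpha>"
  have "closure (D \<alpha>) \<subseteq> closure ?D" for \<alpha> by (intro closure_mono) blast
  then have dense: "closure ?D = UNIV" using D(2) exh by blast
  have "card_of (D \<alpha>) \<le>o card_of (UNIV :: omega_one set)" for \<alpha>
  proof -
    have "card_of (D \<alpha>) \<le>o natLeq" using D(1) by (simp add: countable_iff_natLeq)
    also have "natLeq \<le>o aleph_one"
      by (rule ordLess_imp_ordLeq[OF cardSuc_greater[OF natLeq_Card_order]])
    also have "aleph_one =o card_of (UNIV :: omega_one set)"
      by (rule ordIso_symmetric[OF card_of_omega_one])
    finally show ?thesis .
  qed
  moreover have "infinite (UNIV :: omega_one set)"
    using uncountable_omega_one countable_finite by blast
  moreover have "card_of (UNIV :: omega_one set) \<le>o card_of (UNIV :: omega_one set)"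
    by (rule ordLeq_reflexive[OF card_of_Well_order])
  ultimately have "card_of ?D \<le>o card_of (UNIV :: omega_one set)"
    by (intro card_of_UNION_ordLeq_infinite) auto
  then have "card_of ?D \<le>o aleph_one" by (rule ordLeq_ordIso_trans[OF _ card_of_omega_one])
  then have "card_of ?D =o aleph_one" using lower[OF dense] by (simp add: ordIso_iff_ordLeq)
  then show ?thesis
    unfolding has_density_def using dense lower by auto
qed

text \<open>The sets \<open>S \<alpha>\<close> are the closures of the initial segments of \<open>\<omega>\<^sub>1\<close> under the relation \<open>r\<close>, which
  leads from \<open>i\<close> to the countably many digits on which \<open>g i (pt A)\<close> depends. Closed sets are
  self-determined, and continuity of the chain is automatic, since such a closure is the union of the
  closures of its points.\<close>

theorem digit_map_resolution:
  fixes g :: "omega_one \<Rightarrow> 'a::t2_space \<Rightarrow>\<^sub>C real"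
  assumes dm: "digit_map g pt"
    and K: "compact_space (euclidean :: 'a topology)"
    and weight: "has_weight (euclidean :: 'a topology) aleph_one"
  obtains P :: "omega_one \<Rightarrow> ('a \<Rightarrow>\<^sub>C real) \<Rightarrow>\<^sub>L ('a \<Rightarrow>\<^sub>C real)"
  where "is_PRI P" "\<And>\<alpha>. regular_operator (P \<alpha>)"
proof -
  interpret digit_map g pt by (rule dm)
  have "\<exists>c. countable c \<and> (\<forall>A. apply_bcontfun (g i) (pt A) = apply_bcontfun (g i) (pt (A \<inter> c)))" for i
    using exists_countable_dependency[of "g i"] by metis
  then obtain c where c: "\<And>i. countable (c i)"
    "\<And>i A. apply_bcontfun (g i) (pt A) = apply_bcontfun (g i) (pt (A \<inter> c i))" by metis
  define r where "r = {(i, j). j \<in> c i}"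
  define S where "S \<alpha> = r\<^sup>* `` {..<\<alpha>}" for \<alpha>
  have S_mono: "S \<alpha> \<subseteq> S \<beta>" if "\<alpha> \<le> \<beta>" for \<alpha> \<beta>
    unfolding S_def using that by (intro Image_mono) auto
  have S_self: "self_determined (S \<alpha>)" for \<alpha>
    using c(2) by (rule self_determinedI) (auto simp: S_def r_def intro: rtrancl_into_rtrancl)
  have S_countable: "countable (S \<alpha>)" for \<alpha>
    unfolding S_def
    using c(1) countable_below_omega_one by (intro countable_rtrancl_Image) (auto simp: r_def lessThan_def)
  define C where "C \<alpha> = determined_by (S \<alpha>)" for \<alpha>
  have chain: "projection_chain C (\<lambda>\<alpha>. average (S \<alpha>))"
  proof
    show "C \<alpha> \<subseteq> C \<beta>" if "\<alpha> \<le> \<beta>" for \<alpha> \<beta>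
      unfolding C_def by (rule determined_by_mono[OF S_mono[OF that]])
    show "C \<delta> \<subseteq> closure (\<Union>\<alpha>\<in>{..<\<delta>}. C \<alpha>)" if \<delta>: "limit_ordinal \<delta>" for \<delta>
    proof -
      have directed: "\<exists>\<alpha><\<delta>. J \<subseteq> S \<alpha>" if "finite J" "J \<subseteq> S \<delta>" for J
        using that
      proof (induction J)
        case empty
        then show ?case using \<delta> by (auto simp: limit_ordinal_def)
      next
        case (insert j J)
        then obtain \<alpha> where \<alpha>: "\<alpha> < \<delta>" "J \<subseteq> S \<alpha>" by auto
        obtain \<xi> where \<xi>: "\<xi> < \<delta>" "(\<xi>, j) \<in> r\<^sup>*" using insert.prems by (auto simp: S_def)
        have "osucc \<xi> < \<delta>" using \<delta> \<xi>(1) by (simp add: limit_ordinal_def)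
        moreover have "j \<in> S (osucc \<xi>)" using \<xi>(2) less_osucc by (auto simp: S_def)
        ultimately show ?case
          using \<alpha> S_mono[of \<alpha> "max \<alpha> (osucc \<xi>)"] S_mono[of "osucc \<xi>" "max \<alpha> (osucc \<xi>)"]
          by (intro exI[of _ "max \<alpha> (osucc \<xi>)"]) auto
      qed
      have "\<exists>T\<in>S ` {..<\<delta>}. J \<subseteq> T" if "finite J" "J \<subseteq> S \<delta>" for J
        using directed[OF that] by blast
      then have "determined_by (S \<delta>) \<subseteq> closure (\<Union>T\<in>S ` {..<\<delta>}. determined_by T)"
        by (rule determined_by_directed_union[OF S_self])
      then show ?thesis by (simp add: C_def image_image)
    qed
    show "(\<Union>\<alpha>. C \<alpha>) = UNIV"
    proof -
      have "\<exists>\<alpha>. \<phi> \<in> C \<alpha>" for \<phi>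
      proof -
        obtain T where T: "countable T" "\<phi> \<in> determined_by T" by (rule exists_countable_determining_set)
        obtain \<alpha> where "T \<subseteq> {..<\<alpha>}" using countable_bounded_omega_one[OF T(1)] .
        then have "T \<subseteq> S \<alpha>" by (auto simp: S_def)
        then show ?thesis using T(2) determined_by_mono C_def by blast
      qed
      then show ?thesis by blast
    qed
    show "average (S \<alpha>) x \<in> C \<alpha>" for \<alpha> x unfolding C_def by (rule average_determined_by)
    show "average (S \<alpha>) x = x" if "x \<in> C \<alpha>" for \<alpha> x
      using that S_self average_eq unfolding C_def by blast
    show "norm (average (S \<alpha>)) \<le> 1" for \<alpha> by (rule norm_average_le)
  qed
  then interpret projection_chain C "\<lambda>\<alpha>. average (S \<alpha>)" .
  obtain P :: "omega_one \<Rightarrow> ('a \<Rightarrow>\<^sub>C real) \<Rightarrow>\<^sub>L ('a \<Rightarrow>\<^sub>C real)"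
    where P: "\<And>\<alpha>. norm (P \<alpha>) \<le> 1" "\<And>\<alpha>. range (P \<alpha>) = C \<alpha>" "\<And>\<alpha> x. x \<in> C \<alpha> \<Longrightarrow> P \<alpha> x = x"
    "\<And>\<alpha> \<beta>. \<alpha> \<le> \<beta> \<Longrightarrow> P \<alpha> o\<^sub>L P \<beta> = P \<alpha>" "\<And>\<alpha> \<beta>. \<alpha> \<le> \<beta> \<Longrightarrow> P \<beta> o\<^sub>L P \<alpha> = P \<alpha>"
    by (rule coherent_projections) (rule that)
  have one: "P \<alpha> (const_bcontfun 1) = const_bcontfun 1" for \<alpha>
    by (rule P(3)) (simp add: C_def const_determined_by)
  have sep: "\<exists>D. countable D \<and> C \<alpha> \<subseteq> closure D" for \<alpha>
    using countable_dense_determined_by[OF S_self S_countable, of \<alpha>] unfolding C_def by metis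
  have "is_PRI P"
    unfolding is_PRI_def
  proof (intro conjI allI impI)
    show "has_density (euclidean :: ('a \<Rightarrow>\<^sub>C real) topology) aleph_one"
      by (rule has_density_of_separable_exhaustion[OF card_dense_ge[OF K weight] sep exhausts])
    fix \<alpha>
    show "P \<alpha> o\<^sub>L P \<alpha> = P \<alpha>" by (rule P(4)) simp
    show "norm (P \<alpha>) = 1" by (rule regular_operatorI(2)[OF P(1) one])
    show "separable_space (top_of_set (range (P \<alpha>)))"
    proof -
      obtain D where D: "countable D" "C \<alpha> \<subseteq> closure D" using sep by blast
      have "C \<alpha> \<subseteq> P \<alpha> ` C \<alpha>" using P(3) by force
      also have "\<dots> \<subseteq> P \<alpha> ` closure D" using D(2) by blast
      also have "\<dots> \<subseteq> closure (P \<alpha> ` D)"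
        by (intro image_closure_subset continuous_intros closure_subset closed_closure)
      finally show ?thesis using D(1) P(2) by (intro separable_space_range) auto
    qed
  next
    fix \<alpha> \<beta> :: omega_one assume "\<alpha> < \<beta>"
    then show "P \<alpha> = P \<alpha> o\<^sub>L P \<beta>" "P \<alpha> = P \<beta> o\<^sub>L P \<alpha>" using P(4,5) by simp_all
  next
    show "(\<Union>\<alpha>. range (P \<alpha>)) = UNIV" using P(2) exhausts by simp
  next
    fix \<delta> assume \<delta>: "limit_ordinal \<delta>"
    have "C \<alpha> \<subseteq> C (osucc \<alpha>)" for \<alpha> by (rule mono[OF less_imp_le[OF less_osucc]])
    then have "(\<Union>\<alpha>\<in>{..<\<delta>}. C \<alpha>) \<subseteq> (\<Union>\<alpha>\<in>{..<\<delta>}. C (osucc \<alpha>))" by blast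
    then have "C \<delta> \<subseteq> closure (\<Union>\<alpha>\<in>{..<\<delta>}. C (osucc \<alpha>))"
      using limit[OF \<delta>] closure_mono by blast
    moreover have "C (osucc \<alpha>) \<subseteq> C \<delta>" if "\<alpha> < \<delta>" for \<alpha> using mono[OF osucc_leI[OF that]] .
    then have "closure (\<Union>\<alpha>\<in>{..<\<delta>}. C (osucc \<alpha>)) \<subseteq> C \<delta>"
      by (intro closure_minimal closed_C) auto
    ultimately show "range (P \<delta>) = closure (\<Union>\<alpha>\<in>{..<\<delta>}. range (P (osucc \<alpha>)))"
      unfolding P(2) by blast
  qed
  moreover have "regular_operator (P \<alpha>)" for \<alpha> by (rule regular_operatorI(1)[OF P(1) one])
  ultimately show thesis by (rule that)
qed

section \<open>Countably supported functionals\<close>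

lemma blinfun_compose_right_idem:
  "P o\<^sub>L P = P \<Longrightarrow> (y o\<^sub>L P) o\<^sub>L P = y o\<^sub>L P"
  by (metis blinfun_apply_blinfun_compose blinfun_eqI)

lemma closure_span_add:
  fixes X :: "'e::real_normed_vector set"
  assumes "x \<in> closure (span X)" "y \<in> closure (span X)"
  shows "x + y \<in> closure (span X)"
proof -
  obtain f g where "\<And>n. f n \<in> span X" "f \<longlonglongrightarrow> x" "\<And>n. g n \<in> span X" "g \<longlonglongrightarrow> y"
    using assms unfolding closure_sequential by metis
  then show ?thesis
    unfolding closure_sequential
    by (intro exI[of _ "\<lambda>n. f n + g n"]) (auto intro: span_add tendsto_add)
qed

text \<open>The set \<open>X\<close> consists of the jumps \<open>d - P \<alpha> d\<close>, with \<open>d\<close> in a countable dense subset of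
  \<open>range (P (osucc \<alpha>))\<close>, and of a countable dense subset of the first range. By transfinite
  induction, all ranges lie in its closed linear span. If \<open>y o\<^sub>L P \<beta> = y\<close>, then only the countably many
  jumps at \<open>\<alpha> < \<beta>\<close> can have \<open>y x \<noteq> 0\<close>. The symmetry of \<open>X\<close> and the bound on the norms serve the
  embedding of probability measures into a cube.\<close>

theorem PRI_countably_supported:
  fixes P :: "omega_one \<Rightarrow> 'e::banach \<Rightarrow>\<^sub>L 'e"
  assumes PRI: "is_PRI P"
  obtains X :: "'e set" where "closure (span X) = UNIV"
    and "\<forall>x\<in>X. norm x \<le> 1 \<and> - x \<in> X"
    and "\<forall>\<beta> (y :: 'e \<Rightarrow>\<^sub>L real). y o\<^sub>L P \<beta> = y \<longrightarrow> countable {x \<in> X. y x \<noteq> 0}"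
proof -
  have "\<exists>E. countable E \<and> range (P \<alpha>) \<subseteq> closure E \<and> E \<subseteq> range (P \<alpha>)" for \<alpha>
  proof -
    have "separable_space (top_of_set (range (P \<alpha>)))" using PRI by (simp add: is_PRI_def)
    then obtain E where "countable E" "E \<subseteq> range (P \<alpha>)"
      "top_of_set (range (P \<alpha>)) closure_of E = range (P \<alpha>)"
      unfolding separable_space_def by auto
    then show ?thesis by (intro exI[of _ E]) (auto simp: closure_of_subtopology Int_absorb1)
  qed
  then obtain E where E: "\<And>\<alpha>. countable (E \<alpha>)" "\<And>\<alpha>. range (P \<alpha>) \<subseteq> closure (E \<alpha>)"
    "\<And>\<alpha>. E \<alpha> \<subseteq> range (P \<alpha>)" by metis
  have coherent: "P \<beta> (P \<alpha> x) = P \<beta> x" if "\<beta> \<le> \<alpha>" for \<alpha> \<beta> x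
  proof -
    have "P \<beta> o\<^sub>L P \<alpha> = P \<beta>" using PRI that unfolding is_PRI_def by (metis le_less)
    then show ?thesis by (metis blinfun_apply_blinfun_compose)
  qed
  define Jump where "Jump \<alpha> = (\<lambda>d. d - P \<alpha> d) ` E (osucc \<alpha>)" for \<alpha>
  define z :: omega_one where "z = (LEAST \<alpha>. True)"
  have z: "z \<le> \<alpha>" for \<alpha> unfolding z_def by (rule Least_le) simp
  define X0 where "X0 = E z \<union> (\<Union>\<alpha>. Jump \<alpha>)"
  define X where "X = sgn ` X0 \<union> (\<lambda>x. - sgn x) ` X0"
  let ?V = "closure (span X)"
  have X0V: "X0 \<subseteq> ?V"
  proof
    fix x assume "x \<in> X0"
    then have "norm x *\<^sub>R sgn x \<in> span X" by (intro span_scale span_base) (simp add: X_def)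
    moreover have "norm x *\<^sub>R sgn x = x" by (cases "x = 0") (simp_all add: sgn_div_norm)
    ultimately have "x \<in> span X" by simp
    then show "x \<in> ?V" using closure_subset by blast
  qed
  have "range (P \<alpha>) \<subseteq> ?V" for \<alpha>
  proof (induction \<alpha> rule: less_induct)
    case (less \<alpha>)
    show ?case
    proof (cases \<alpha> rule: ordinal_cases)
      case least
      then have "\<alpha> = z" using z by (simp add: antisym)
      then have "E \<alpha> \<subseteq> ?V" using X0V by (auto simp: X0_def)
      then show ?thesis using E(2)[of \<alpha>] closure_minimal[of "E \<alpha>" ?V] by auto
    next
      case (succ \<beta>)
      have "E \<alpha> \<subseteq> ?V"
      proof
        fix d assume "d \<in> E \<alpha>"
        then have "d - P \<beta> d \<in> X0" by (auto simp: succ X0_def Jump_def)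
        then have "d - P \<beta> d \<in> ?V" using X0V by blast
        moreover have "P \<beta> d \<in> ?V" using less.IH[of \<beta>] less_osucc succ by auto
        ultimately have "(d - P \<beta> d) + P \<beta> d \<in> ?V" by (rule closure_span_add)
        then show "d \<in> ?V" by simp
      qed
      then show ?thesis using E(2)[of \<alpha>] closure_minimal[of "E \<alpha>" ?V] by auto
    next
      case limit
      then have "range (P \<alpha>) = closure (\<Union>\<beta>\<in>{..<\<alpha>}. range (P (osucc \<beta>)))"
        using PRI by (simp add: is_PRI_def)
      moreover have "(\<Union>\<beta>\<in>{..<\<alpha>}. range (P (osucc \<beta>))) \<subseteq> ?V"
        using less.IH limit unfolding limit_ordinal_def by blast
      ultimately show ?thesis using closure_minimal[of _ ?V] by simp
    qed
  qed
  moreover have "(\<Union>\<alpha>. range (P \<alpha>)) = UNIV" using PRI by (simp add: is_PRI_def)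
  ultimately have dense: "?V = UNIV" by blast
  have supp: "countable {x \<in> X. y x \<noteq> 0}" if y: "y o\<^sub>L P \<beta> = y" for \<beta> and y :: "'e \<Rightarrow>\<^sub>L real"
  proof -
    have yP: "y (P \<beta> x) = y x" for x using y by (metis blinfun_apply_blinfun_compose)
    have "y x = 0" if "x \<in> Jump \<alpha>" "\<beta> \<le> \<alpha>" for x \<alpha>
    proof -
      obtain d where "x = d - P \<alpha> d" using \<open>x \<in> Jump \<alpha>\<close> by (auto simp: Jump_def)
      then have "P \<beta> x = 0" using coherent[OF \<open>\<beta> \<le> \<alpha>\<close>] by (simp add: blinfun.diff_right)
      then show ?thesis using yP[of x] by simp
    qed
    then have "{x \<in> X0. y x \<noteq> 0} \<subseteq> E z \<union> (\<Union>\<alpha>\<in>{\<alpha>. \<alpha> < \<beta>}. Jump \<alpha>)"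
      unfolding X0_def by (auto simp: not_le[symmetric])
    moreover have "countable (E z \<union> (\<Union>\<alpha>\<in>{\<alpha>. \<alpha> < \<beta>}. Jump \<alpha>))"
      using E(1) countable_below_omega_one unfolding Jump_def by (intro countable_Un countable_UN) auto
    ultimately have "countable {x \<in> X0. y x \<noteq> 0}" by (rule countable_subset)
    moreover have "{x \<in> X. y x \<noteq> 0} \<subseteq> sgn ` {x \<in> X0. y x \<noteq> 0} \<union> (\<lambda>x. - sgn x) ` {x \<in> X0. y x \<noteq> 0}"
      by (auto simp: X_def sgn_div_norm blinfun.scaleR_right blinfun.minus_right)
    ultimately show ?thesis by (meson countable_Un countable_image countable_subset)
  qed
  have ball: "\<forall>x\<in>X. norm x \<le> 1 \<and> - x \<in> X" unfolding X_def by (auto simp: norm_sgn)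
  show thesis
    using supp by (intro that[OF dense ball] allI impI)
qed

lemma compact_norm_attained:
  fixes v :: "'a::topological_space \<Rightarrow>\<^sub>C real"
  assumes "compact_space (euclidean :: 'a topology)"
  obtains x where "\<bar>apply_bcontfun v x\<bar> = norm v"
proof -
  have "compact (UNIV :: 'a set)" using assms by (simp add: compact_space_def)
  moreover have "continuous_on UNIV (\<lambda>x. \<bar>apply_bcontfun v x\<bar>)"
    by (intro continuous_intros continuous_on_apply_bcontfun)
  ultimately obtain x where x: "\<And>y. \<bar>apply_bcontfun v y\<bar> \<le> \<bar>apply_bcontfun v x\<bar>"
    using continuous_attains_sup[of UNIV] by blast
  then have "norm v \<le> \<bar>apply_bcontfun v x\<bar>" by (intro norm_bound) simp
  then show thesis using apply_bcontfun_le_norm[of v x] by (intro that[of x]) simp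
qed

text \<open>The norm of \<open>v \<in> range (P \<beta>)\<close> is attained at a point \<open>x\<close>, and evaluation at \<open>x\<close> composed with
  \<open>P \<beta>\<close> is a functional of norm at most \<open>1\<close> with the same value at \<open>v\<close>.\<close>

theorem one_plichko_bcontfun:
  fixes P :: "omega_one \<Rightarrow> ('a::topological_space \<Rightarrow>\<^sub>C real) \<Rightarrow>\<^sub>L ('a \<Rightarrow>\<^sub>C real)"
  assumes K: "compact_space (euclidean :: 'a topology)" and PRI: "is_PRI P"
  shows "one_plichko TYPE('a \<Rightarrow>\<^sub>C real)"
proof -
  obtain X :: "('a \<Rightarrow>\<^sub>C real) set" where X: "closure (span X) = UNIV"
    "\<forall>\<beta> (y :: ('a \<Rightarrow>\<^sub>C real) \<Rightarrow>\<^sub>L real). y o\<^sub>L P \<beta> = y \<longrightarrow> countable {x \<in> X. y x \<noteq> 0}"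
    by (rule PRI_countably_supported[OF PRI]) (rule that)
  let ?Y = "{y :: ('a \<Rightarrow>\<^sub>C real) \<Rightarrow>\<^sub>L real. \<exists>\<beta>. y o\<^sub>L P \<beta> = y}"
  have "one_norming ?Y"
    unfolding one_norming_def
  proof
    fix v :: "'a \<Rightarrow>\<^sub>C real"
    show "ennreal (norm v) \<le> (SUP y\<in>?Y - {0}. ennreal (\<bar>blinfun_apply y v\<bar> / norm y))"
    proof (cases "v = 0")
      case False
      obtain \<beta> where "v \<in> range (P \<beta>)" using PRI unfolding is_PRI_def by blast
      moreover have idem: "P \<beta> o\<^sub>L P \<beta> = P \<beta>" and norm: "norm (P \<beta>) = 1"
        using PRI unfolding is_PRI_def by blast+
      ultimately have v: "P \<beta> v = v" by (metis blinfun_apply_blinfun_compose rangeE)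
      obtain x where x: "\<bar>apply_bcontfun v x\<bar> = norm v" using compact_norm_attained[OF K] .
      let ?y = "point_evaluation x o\<^sub>L P \<beta>"
      have yv: "\<bar>?y v\<bar> = norm v" using v x by simp
      then have ne: "?y \<noteq> 0" using False by force
      have "norm ?y \<le> 1"
        using norm_blinfun_compose[of "point_evaluation x" "P \<beta>"] norm_point_evaluation_le[of x] norm by simp
      then have "norm v \<le> \<bar>?y v\<bar> / norm ?y"
        using ne yv by (simp add: le_divide_eq mult_left_le)
      moreover have "?y \<in> ?Y - {0}" using ne idem blinfun_compose_right_idem[OF idem] by auto
      ultimately show ?thesis by (intro SUP_upper2[of ?y] ennreal_leI)
    qed simp
  qed
  then show ?thesis unfolding one_plichko_def using X by blast
qed

section \<open>The space of probability measures\<close>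

definition prob_functionals :: "(('a::topological_space \<Rightarrow>\<^sub>C real) \<Rightarrow>\<^sub>L real) set"
  where "prob_functionals =
    {\<mu>. norm \<mu> = 1 \<and> (\<forall>\<phi>. (\<forall>x. 0 \<le> apply_bcontfun \<phi> x) \<longrightarrow> 0 \<le> blinfun_apply \<mu> \<phi>)}"

lemma topspace_prob_space_topology: "topspace prob_space_topology = prob_functionals"
  by (simp add: prob_space_topology_def prob_functionals_def strong_operator_topology_topspace)

text \<open>Apply \<open>m\<close> to the non-negative functions \<open>\<parallel>\<phi>\<parallel> - \<phi>\<close> and \<open>\<parallel>\<phi>\<parallel> + \<phi>\<close>.\<close>

lemma positive_functional_bound:
  fixes m :: "('a::topological_space \<Rightarrow>\<^sub>C real) \<Rightarrow> real"
  assumes m: "linear m" and pos: "\<And>\<phi>. (\<forall>x. 0 \<le> apply_bcontfun \<phi> x) \<Longrightarrow> 0 \<le> m \<phi>"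
  shows "\<bar>m \<phi>\<bar> \<le> m (const_bcontfun 1) * norm \<phi>"
proof -
  let ?c = "norm \<phi> *\<^sub>R const_bcontfun 1 :: 'a \<Rightarrow>\<^sub>C real"
  have b: "- norm \<phi> \<le> apply_bcontfun \<phi> x \<and> apply_bcontfun \<phi> x \<le> norm \<phi>" for x
    using apply_bcontfun_le_norm[of \<phi> x] by (simp add: abs_le_iff)
  have "0 \<le> m (?c - \<phi>)" "0 \<le> m (?c + \<phi>)"
    using b by (auto intro!: pos simp: algebra_simps) (metis add.commute neg_le_iff_le minus_le_iff le_minus_iff diff_ge_0_iff_ge diff_minus_eq_add)
  then show ?thesis
    by (simp add: linear_diff[OF m] linear_add[OF m] linear_scale[OF m] abs_le_iff mult.commute)
qed

lemma prob_functionals_iff: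
  "\<mu> \<in> prob_functionals \<longleftrightarrow> \<mu> (const_bcontfun 1) = 1 \<and>
    (\<forall>\<phi>. (\<forall>x. 0 \<le> apply_bcontfun \<phi> x) \<longrightarrow> 0 \<le> blinfun_apply \<mu> \<phi>)"
proof -
  have "norm \<mu> = \<mu> (const_bcontfun 1)"
    if pos: "\<And>\<phi>. (\<forall>x. 0 \<le> apply_bcontfun \<phi> x) \<Longrightarrow> 0 \<le> blinfun_apply \<mu> \<phi>"
  proof (rule antisym)
    have "linear \<mu>" using blinfun.bounded_linear_right bounded_linear.linear by blast
    then show "norm \<mu> \<le> \<mu> (const_bcontfun 1)"
      using positive_functional_bound[OF _ pos] pos[of "const_bcontfun 1"]
      by (intro norm_blinfun_bound) simp_all
    show "\<mu> (const_bcontfun 1) \<le> norm \<mu>"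
      using norm_blinfun[of \<mu> "const_bcontfun 1"] by (simp add: norm_const_bcontfun_1)
  qed
  then show ?thesis unfolding prob_functionals_def by auto
qed

lemma continuous_map_prob_evaluation:
  "continuous_map prob_space_topology euclideanreal (\<lambda>\<mu>. blinfun_apply \<mu> \<phi>)"
  unfolding prob_space_topology_def
  by (rule continuous_map_from_subtopology[OF strong_operator_topology_continuous_evaluation])

lemma Hausdorff_space_prob_space_topology: "Hausdorff_space prob_space_topology"
proof (rule Hausdorff_space_injective_preimage)
  show "Hausdorff_space (product_topology (\<lambda>_. euclideanreal) (UNIV :: ('a \<Rightarrow>\<^sub>C real) set))"
    by (simp add: Hausdorff_space_product_topology)
  show "continuous_map prob_space_topology (product_topology (\<lambda>_. euclideanreal) UNIV) blinfun_apply"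
    by (simp add: continuous_map_componentwise_UNIV continuous_map_prob_evaluation)
  show "inj_on blinfun_apply (topspace prob_space_topology)"
    by (auto simp: inj_on_def blinfun_apply_inject)
qed

text \<open>As in the Banach-Alaoglu theorem, positive normalised linear functionals
  form a closed subset \<open>M\<close> of the compact product of the intervals \<open>[-\<parallel>\<phi>\<parallel>, \<parallel>\<phi>\<parallel>]\<close>, and every
  member of \<open>M\<close> is automatically bounded.\<close>

lemma compact_space_prob_space_topology:
  "compact_space (prob_space_topology :: (('a::topological_space \<Rightarrow>\<^sub>C real) \<Rightarrow>\<^sub>L real) topology)"
proof -
  define M :: "(('a \<Rightarrow>\<^sub>C real) \<Rightarrow> real) set" where
    "M = {m. (\<forall>\<phi> \<psi>. m (\<phi> + \<psi>) = m \<phi> + m \<psi>) \<and> (\<forall>c \<phi>. m (c *\<^sub>R \<phi>) = c * m \<phi>) \<and>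
      (\<forall>\<phi>\<in>{\<phi>. \<forall>x. 0 \<le> apply_bcontfun \<phi> x}. 0 \<le> m \<phi>) \<and> m (const_bcontfun 1) = 1}"
  have bound: "\<bar>m \<phi>\<bar> \<le> norm \<phi>" if "m \<in> M" for m \<phi>
  proof -
    have "linear m" using that by (intro linearI) (auto simp: M_def)
    then show ?thesis using positive_functional_bound[of m \<phi>] that by (auto simp: M_def)
  qed
  have "closed (\<Inter>\<phi>\<in>{\<phi>. \<forall>x. 0 \<le> apply_bcontfun \<phi> x}. {m :: ('a \<Rightarrow>\<^sub>C real) \<Rightarrow> real. 0 \<le> m \<phi>})"
    by (intro closed_INT ballI closed_Collect_le continuous_on_const continuous_on_product_coordinates)
  moreover have "(\<Inter>\<phi>\<in>{\<phi>. \<forall>x. 0 \<le> apply_bcontfun \<phi> x}. {m :: ('a \<Rightarrow>\<^sub>C real) \<Rightarrow> real. 0 \<le> m \<phi>}) =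
      {m. \<forall>\<phi>\<in>{\<phi>. \<forall>x. 0 \<le> apply_bcontfun \<phi> x}. 0 \<le> m \<phi>}" by auto
  ultimately have "closed M"
    unfolding M_def
    by (intro closed_Collect_conj closed_Collect_all closed_Collect_eq continuous_on_add
        continuous_on_mult continuous_on_const continuous_on_product_coordinates) simp
  moreover have "compact (Pi\<^sub>E UNIV (\<lambda>\<phi> :: 'a \<Rightarrow>\<^sub>C real. {- norm \<phi>..norm \<phi>}))"
    using compactin_PiE[of "\<lambda>_. euclideanreal" UNIV "\<lambda>\<phi> :: 'a \<Rightarrow>\<^sub>C real. {- norm \<phi>..norm \<phi>}"]
    by (simp add: euclidean_product_topology)
  moreover have "M \<subseteq> Pi\<^sub>E UNIV (\<lambda>\<phi>. {- norm \<phi>..norm \<phi>})"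
  proof
    fix m assume "m \<in> M"
    then have "m \<phi> \<in> {- norm \<phi>..norm \<phi>}" for \<phi>
      using bound[of m \<phi>] by (simp add: abs_le_iff minus_le_iff)
    then show "m \<in> Pi\<^sub>E UNIV (\<lambda>\<phi>. {- norm \<phi>..norm \<phi>})" by (simp add: PiE_UNIV_domain)
  qed
  ultimately have "compact M" using compact_Int_closed by (metis inf.absorb_iff2)
  then have M: "compactin (top_of_set M) M" by (simp add: compactin_subtopology)
  have apply_Blinfun: "blinfun_apply (Blinfun m) = m" if "m \<in> M" for m
  proof -
    have "bounded_linear m"
      by (rule bounded_linear_intro[where K=1]) (use that bound[OF that] in \<open>auto simp: M_def\<close>)
    then show ?thesis by (rule bounded_linear_Blinfun_apply)
  qed
  have image: "Blinfun ` M = prob_functionals"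
  proof
    show "Blinfun ` M \<subseteq> prob_functionals"
      using apply_Blinfun by (auto simp: prob_functionals_iff) (auto simp: M_def)
    show "prob_functionals \<subseteq> Blinfun ` M"
    proof
      fix \<mu> :: "('a \<Rightarrow>\<^sub>C real) \<Rightarrow>\<^sub>L real" assume "\<mu> \<in> prob_functionals"
      then have "blinfun_apply \<mu> \<in> M"
        by (simp add: M_def prob_functionals_iff blinfun.add_right blinfun.scaleR_right)
      then show "\<mu> \<in> Blinfun ` M" by (metis blinfun_apply_inverse image_eqI)
    qed
  qed
  have "continuous_map (top_of_set M) strong_operator_topology Blinfun"
    unfolding continuous_on_strong_operator_topo_iff_coordinatewise
  proof
    fix \<phi> :: "'a \<Rightarrow>\<^sub>C real"
    have "continuous_on M (\<lambda>m. m \<phi>)"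
      by (rule continuous_on_subset[OF continuous_on_product_coordinates subset_UNIV])
    then have "continuous_on M (\<lambda>m. blinfun_apply (Blinfun m) \<phi>)"
      by (rule continuous_on_eq) (simp add: apply_Blinfun)
    then show "continuous_map (top_of_set M) euclideanreal (\<lambda>m. blinfun_apply (Blinfun m) \<phi>)" by simp
  qed
  then have "compactin strong_operator_topology (Blinfun ` M)" by (rule image_compactin[OF M])
  then show ?thesis
    unfolding image prob_space_topology_def prob_functionals_def[symmetric]
    by (rule compact_space_subtopology)
qed

text \<open>The coordinates of \<open>\<mu>\<close> are the positive parts of \<open>\<mu> x\<close> for \<open>x \<in> X\<close>. They lie in \<open>[0,1]\<close> because
  \<open>X\<close> is in the unit ball, and they determine \<open>\<mu>\<close> because \<open>X\<close> is symmetric and linearly dense. A basic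
  neighbourhood restricts finitely many coordinates, all of which lie in a common \<open>range (P \<beta>)\<close>. There
  \<open>\<mu>\<close> agrees with \<open>\<mu> o\<^sub>L P \<beta>\<close>, which is a probability functional because \<open>P \<beta>\<close> is regular
  and which has countable support in \<open>X\<close>.\<close>

theorem valdivia_compact_prob_space:
  fixes P :: "omega_one \<Rightarrow> ('a::topological_space \<Rightarrow>\<^sub>C real) \<Rightarrow>\<^sub>L ('a \<Rightarrow>\<^sub>C real)"
  assumes PRI: "is_PRI P" and regular: "\<And>\<alpha>. regular_operator (P \<alpha>)"
  shows "valdivia_compact (prob_space_topology :: (('a \<Rightarrow>\<^sub>C real) \<Rightarrow>\<^sub>L real) topology)"
proof -
  obtain X :: "('a \<Rightarrow>\<^sub>C real) set" where X: "closure (span X) = UNIV"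
    "\<forall>x\<in>X. norm x \<le> 1 \<and> - x \<in> X"
    "\<forall>\<beta> (y :: ('a \<Rightarrow>\<^sub>C real) \<Rightarrow>\<^sub>L real). y o\<^sub>L P \<beta> = y \<longrightarrow> countable {x \<in> X. y x \<noteq> 0}"
    by (rule PRI_countably_supported[OF PRI]) (rule that)
  let ?L = "prob_space_topology :: (('a \<Rightarrow>\<^sub>C real) \<Rightarrow>\<^sub>L real) topology"
  define h where "h \<mu> = (\<lambda>x\<in>X. max 0 (blinfun_apply \<mu> x))" for \<mu> :: "('a \<Rightarrow>\<^sub>C real) \<Rightarrow>\<^sub>L real"
  have h_le: "max 0 (blinfun_apply \<mu> x) \<in> {0..1}" if "x \<in> X" "\<mu> \<in> prob_functionals" for \<mu> x
  proof -
    have "norm \<mu> = 1" "norm x \<le> 1" using that X(2) by (auto simp: prob_functionals_def)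
    then show ?thesis using norm_blinfun[of \<mu> x] by (simp add: abs_le_iff)
  qed
  have h_cont: "continuous_map ?L (cube X) h"
    unfolding cube_def h_def
  proof (subst continuous_map_componentwise, intro conjI ballI)
    fix x assume x: "x \<in> X"
    have "continuous_map ?L euclideanreal (\<lambda>\<mu>. max 0 (blinfun_apply \<mu> x))"
      by (intro continuous_map_real_max continuous_map_prob_evaluation) simp
    then show "continuous_map ?L (top_of_set {0..1}) (\<lambda>\<mu>. (\<lambda>x\<in>X. max 0 (blinfun_apply \<mu> x)) x)"
      using x h_le by (simp add: continuous_map_in_subtopology topspace_prob_space_topology image_subset_iff)
  qed auto
  have h_inj: "inj_on h prob_functionals"
  proof (rule inj_onI)
    fix \<mu> \<nu> :: "('a \<Rightarrow>\<^sub>C real) \<Rightarrow>\<^sub>L real" assume "h \<mu> = h \<nu>"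
    then have hx: "max 0 (\<mu> x) = max 0 (\<nu> x)" if "x \<in> X" for x
      using that by (metis h_def restrict_apply')
    have eqX: "\<mu> x = \<nu> x" if "x \<in> X" for x
      using hx[OF that] hx[of "- x"] that X(2) by (auto simp: blinfun.minus_right max_def split: if_splits)
    have "span X \<subseteq> {x. \<mu> x = \<nu> x}"
    proof
      fix x assume "x \<in> span X"
      then have "\<mu> x = \<nu> x"
        using eqX by (induction rule: span_induct_alt) (simp_all add: blinfun.add_right blinfun.scaleR_right)
      then show "x \<in> {x. \<mu> x = \<nu> x}" by simp
    qed
    moreover have "closed {x. \<mu> x = \<nu> x}" by (auto intro!: closed_Collect_eq continuous_intros)
    ultimately have "closure (span X) \<subseteq> {x. \<mu> x = \<nu> x}" by (rule closure_minimal)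
    then show "\<mu> = \<nu>" using X(1) by (intro blinfun_eqI) auto
  qed
  let ?L' = "h ` prob_functionals"
  have sub: "?L' \<subseteq> topspace (cube X)"
    using continuous_map_image_subset_topspace[OF h_cont] by (simp add: topspace_prob_space_topology)
  then have top': "topspace (subtopology (cube X) ?L') = ?L'" by auto
  have "homeomorphic_map ?L (subtopology (cube X) ?L') h"
  proof (rule continuous_imp_homeomorphic_map)
    show "continuous_map ?L (subtopology (cube X) ?L') h"
      using h_cont by (simp add: continuous_map_in_subtopology topspace_prob_space_topology)
    show "Hausdorff_space (subtopology (cube X) ?L')"
      unfolding cube_def by (intro Hausdorff_space_subtopology)
        (simp add: Hausdorff_space_product_topology Hausdorff_space_subtopology)
  qed (use compact_space_prob_space_topology h_inj top' in \<open>simp_all add: topspace_prob_space_topology\<close>)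
  then have hom: "?L homeomorphic_space subtopology (cube X) ?L'"
    by (rule homeomorphic_map_imp_homeomorphic_space)
  have PP: "P \<alpha> o\<^sub>L P \<alpha> = P \<alpha>" for \<alpha> using PRI by (simp add: is_PRI_def)
  have range_mono: "range (P \<alpha>) \<subseteq> range (P \<beta>)" if "\<alpha> \<le> \<beta>" for \<alpha> \<beta>
  proof (cases "\<alpha> = \<beta>")
    case False
    then have "P \<alpha> = P \<beta> o\<^sub>L P \<alpha>" using PRI that unfolding is_PRI_def by (metis le_less)
    then show ?thesis by (metis blinfun_apply_blinfun_compose image_subsetI rangeI)
  qed simp
  have dense: "h \<mu> \<in> subtopology (cube X) ?L' closure_of (?L' \<inter> Sigma_product X)"
    if \<mu>: "\<mu> \<in> prob_functionals" for \<mu>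
    unfolding in_closure_of
  proof (intro conjI allI impI)
    show "h \<mu> \<in> topspace (subtopology (cube X) ?L')" using \<mu> top' by blast
    fix T assume T: "h \<mu> \<in> T \<and> openin (subtopology (cube X) ?L') T"
    then obtain W where W: "openin (cube X) W" "T = W \<inter> ?L'" unfolding openin_subtopology by blast
    have "h \<mu> \<in> W" using T W(2) by blast
    obtain U where U: "finite {x \<in> X. U x \<noteq> topspace (top_of_set {0..1::real})}"
      "h \<mu> \<in> Pi\<^sub>E X U" "Pi\<^sub>E X U \<subseteq> W"
      using bspec[OF iffD1[OF openin_product_topology_alt W(1)[unfolded cube_def]] \<open>h \<mu> \<in> W\<close>]
      by (elim exE conjE) (rule that)
    define J where "J = {x \<in> X. U x \<noteq> {0..1}}"
    have "finite J" using U(1) by (simp add: J_def)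
    then have "\<exists>\<beta>. J \<subseteq> range (P \<beta>)"
    proof (induction J)
      case (insert x J)
      then obtain \<beta> where "J \<subseteq> range (P \<beta>)" by blast
      moreover obtain \<gamma> where "x \<in> range (P \<gamma>)" using PRI unfolding is_PRI_def by blast
      ultimately show ?case
        using range_mono[of \<beta> "max \<beta> \<gamma>"] range_mono[of \<gamma> "max \<beta> \<gamma>"]
        by (intro exI[of _ "max \<beta> \<gamma>"]) auto
    qed simp
    then obtain \<beta> where \<beta>: "J \<subseteq> range (P \<beta>)" ..
    let ?\<nu> = "\<mu> o\<^sub>L P \<beta>"
    have \<nu>: "?\<nu> \<in> prob_functionals"
      using \<mu> regular[of \<beta>] by (simp add: prob_functionals_iff regular_operator_def)
    have "h ?\<nu> \<in> Pi\<^sub>E X U"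
    proof (rule PiE_I)
      fix x assume x: "x \<in> X"
      show "h ?\<nu> x \<in> U x"
      proof (cases "x \<in> J")
        case True
        then obtain v where "x = P \<beta> v" using \<beta> by blast
        then have "P \<beta> x = x" using PP[of \<beta>] by (metis blinfun_apply_blinfun_compose)
        then have "h ?\<nu> x = h \<mu> x" using x by (simp add: h_def)
        then show ?thesis using U(2) x by auto
      next
        case False
        then have "U x = {0..1}" using x by (simp add: J_def)
        then show ?thesis using h_le[OF x \<nu>] x by (simp add: h_def)
      qed
    qed (simp add: h_def)
    then have "h ?\<nu> \<in> T" using U(3) W(2) \<nu> by blast
    moreover have "h ?\<nu> \<in> Sigma_product X"
    proof -
      have "?\<nu> o\<^sub>L P \<beta> = ?\<nu>" by (rule blinfun_compose_right_idem[OF PP])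
      then have "countable {x \<in> X. ?\<nu> x \<noteq> 0}" using X(3) by blast
      then have "countable {x \<in> X. h ?\<nu> x \<noteq> 0}"
        by (rule countable_subset[rotated]) (auto simp: h_def)
      then show ?thesis using sub \<nu> unfolding Sigma_product_def by blast
    qed
    ultimately show "\<exists>y. y \<in> ?L' \<inter> Sigma_product X \<and> y \<in> T" using \<nu> by blast
  qed
  then have "?L' \<subseteq> subtopology (cube X) ?L' closure_of (?L' \<inter> Sigma_product X)" by blast
  then have "subtopology (cube X) ?L' closure_of (?L' \<inter> Sigma_product X) = ?L'"
    using closure_of_subset_topspace[of "subtopology (cube X) ?L'"] top' by blast
  then have "valdivia_embeddable X ?L" unfolding valdivia_embeddable_def using sub hom by blast
  then show ?thesis
    by (rule valdivia_compactI[OF compact_space_prob_space_topology Hausdorff_space_prob_space_topology])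
qed

section \<open>Dugundji compact spaces of weight \<open>\<aleph>\<^sub>1\<close>\<close>

theorem theorem3p1:
  assumes "dugundji_compact (euclidean :: 'a::t2_space topology)"
    and "has_weight (euclidean :: 'a topology) aleph_one"
  shows "(\<exists>P :: omega_one \<Rightarrow> ('a \<Rightarrow>\<^sub>C real) \<Rightarrow>\<^sub>L ('a \<Rightarrow>\<^sub>C real).
            is_PRI P \<and> (\<forall>\<alpha>. regular_operator (blinfun_apply (P \<alpha>))))
       \<and> one_plichko TYPE('a \<Rightarrow>\<^sub>C real)
       \<and> valdivia_compact (prob_space_topology :: (('a \<Rightarrow>\<^sub>C real) \<Rightarrow>\<^sub>L real) topology)"
proof -
  have K: "compact_space (euclidean :: 'a topology)" using assms(1) by (simp add: dugundji_compact_def)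
  obtain g :: "omega_one \<Rightarrow> 'a \<Rightarrow>\<^sub>C real"
    where g: "\<And>x y. x \<noteq> y \<Longrightarrow> \<exists>i. apply_bcontfun (g i) x < 0 \<and> 1 < apply_bcontfun (g i) y"
    by (rule has_weight_separating_family[OF K assms(2)]) (rule that)
  obtain pt where pt: "digit_map g pt" by (rule dugundji_digit_map[OF assms(1) g])
  obtain P :: "omega_one \<Rightarrow> ('a \<Rightarrow>\<^sub>C real) \<Rightarrow>\<^sub>L ('a \<Rightarrow>\<^sub>C real)"
    where P: "is_PRI P" "\<And>\<alpha>. regular_operator (P \<alpha>)"
    by (rule digit_map_resolution[OF pt K assms(2)]) (rule that)
  show ?thesis
    using P one_plichko_bcontfun[OF K P(1)] valdivia_compact_prob_space[OF P] by blast
qed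

end
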